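(* Let $n\ge 4$. Let $I_n\subseteq \mathbb{C}\langle n^2\rangle$ be the two-sided ideal of quantum symmetries, and fix the graded lexicographic order with row-wise ordering of the symbols. Define $G_n$ as the union of the following sets, where all indices $i,j,k$ range over $\{2,\dots,n\}$: (1) $\{\mathsf{cs}_1\}$; (2) all $\mathsf{cs}_i$, all $\mathsf{rs}_i$, all $\mathsf{ip}_{ij}$, all $\mathsf{inj}_{ijk}$ with $i\ne k$, all $\mathsf{wel}_{ijk}$ with $j\neq k$, all $\mathsf{rinj}_{kj}$ with $k\ne j$, and all $\mathsf{rwel}_{kj}$ with $k\neq j$ and $(k,j)\ne(2,3)$; (3) all $\mathsf{rinj}_{kj}u_{i3}-u_{k2}\,\mathsf{inj}_{j3i}$ with $k\ne j$, $j\neq i$, $(k,j)\ne(2,3)$ and $(j,i)\ne(2,3)$; (4) all $\mathsf{rwel}_{kj}u_{3i}-u_{2k}\,\mathsf{wel}_{3ji}$ with $k\neq j$, $j\ne i$, $(k,j)\neq(2,3)$, $(j,i)\ne(2,3)$ and $(k,j,i)\neq(2,4,3)$. Then $G_n$ is a finite, monic and reduced Gröbner basis of $I_n$, and its cardinality is $\#G_n=4n^3-15n^2+16n-2$.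
   Context: $\mathbb{C}\langle n^2\rangle=\mathbb{C}\langle u_{ij}\mid 1\le i,j\le n\rangle$ is the free associative unital algebra on $n^2$ symbols $u_{ij}$. For $1\le i,j,k\le n$ put $\mathsf{rs}_i=\sum_{\alpha=1}^n u_{i\alpha}-1$, $\mathsf{cs}_i=\sum_{\alpha=1}^n u_{\alpha i}-1$, $\mathsf{ip}_{ij}=u_{ij}^2-u_{ij}$; for $j\ne k$, $\mathsf{inj}_{jik}=u_{ji}u_{ki}$ and $\mathsf{wel}_{ijk}=u_{ij}u_{ik}$. (So $\mathsf{inj}_{abc}=u_{ab}u_{cb}$ with $a\ne c$, and $\mathsf{wel}_{abc}=u_{ab}u_{ac}$ with $b\ne c$.) $I_n$ is the two-sided ideal generated by all $\mathsf{rs}_i,\mathsf{cs}_i,\mathsf{ip}_{ij},\mathsf{inj}_{jik},\mathsf{wel}_{ijk}$ with $1\le i,j,k\le n$, $j\ne k$. For $2\le j,k\le n$, $j\ne k$: $$\mathsf{rinj}_{jk}=\sum_{\alpha=3}^n u_{j2}u_{k\alpha}-\sum_{\alpha=3}^n u_{j\alpha}u_{k1}+u_{k1}-u_{j2},$$ $$\mathsf{rwel}_{jk}=\sum_{\alpha=3}^n u_{2j}u_{\alpha k}-\sum_{\alpha=3}^n u_{\alpha j}u_{1k}+u_{1k}-u_{2j}.$$ Monomials are the words in the $u_{ij}$. The order: compare words first by length, then words of equal length lexicographically from left to right, with symbols ordered row-wise, $u_{11}>u_{12}>\dots>u_{1n}>u_{21}>\dots>u_{nn}$. $\operatorname{lm}(f)$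 and $\operatorname{lc}(f)$ are the leading monomial and leading coefficient of $f\neq0$. A monomial $v$ divides $w$ if $w=avb$ for some (possibly empty) words $a,b$. A set $G\subseteq I$ is a Gröbner basis of a two-sided ideal $I$ if for every $f\in I\setminus\{0\}$ there is $g\in G$ with $\operatorname{lm}(g)$ dividing $\operatorname{lm}(f)$. A set $F$ is reduced if $\operatorname{lm}(f)$ does not divide $\operatorname{lm}(g)$ for all distinct $f,g\in F$; it is monic if $\operatorname{lc}(f)=1$ for all $f\in F$. *)

theory Defs
  imports
    Complex_Main
    "HOL-Library.Poly_Mapping"
    "HOL-Library.Sublist"
    "HOL-Algebra.Ideal"
begin

text \<open>
  With concatenation as addition, lists form the free monoid, so that
  \<^typ>\<open>'a list \<Rightarrow>\<^sub>0 complex\<close> under the convolution product of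
  \<^theory>\<open>HOL-Library.Poly_Mapping\<close> is the free associative unital algebra on \<^typ>\<open>'a\<close>.
\<close>

instantiation list :: (type) monoid_add
begin

definition zero_list :: "'a list" where "zero_list = []"

definition plus_list :: "'a list \<Rightarrow> 'a list \<Rightarrow> 'a list" where "plus_list xs ys = xs @ ys"

instance by standard (simp_all add: zero_list_def plus_list_def)

end

text \<open>The symbol \<open>u\<^sub>i\<^sub>j\<close> is encoded by the pair \<open>(i, j)\<close>.\<close>

type_synonym word = "(nat \<times> nat) list"
type_synonym ncpoly = "word \<Rightarrow>\<^sub>0 complex"

definition u :: "nat \<Rightarrow> nat \<Rightarrow> ncpoly" where
  "u i j = Poly_Mapping.single [(i, j)] 1"

text \<open>
  The algebra on the \<open>n\<^sup>2\<close> symbols with indices in \<open>{1..n}\<close> is the subring of polynomials all of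
  whose words use only these symbols. Since it contains the scalars, which are central, its
  two-sided ring ideals are the same as its two-sided algebra ideals.
\<close>

definition free_algebra :: "nat \<Rightarrow> ncpoly ring" where
  "free_algebra n =
     \<lparr>carrier = {f. Poly_Mapping.keys f \<subseteq> lists ({1..n} \<times> {1..n})},
      monoid.mult = (*), one = 1, ring.zero = 0, add = (+)\<rparr>"

lemma ring_free_algebra: "ring (free_algebra n)"
proof -
  define A where "A = {f :: ncpoly. Poly_Mapping.keys f \<subseteq> lists ({1..n} \<times> {1..n})}"
  have plus: "f + g \<in> A" if "f \<in> A" "g \<in> A" for f g
    using that Poly_Mapping.keys_add[of f g] unfolding A_def by blast
  have mult: "f * g \<in> A" if "f \<in> A" "g \<in> A" for f g
  proof -
    have "v + w \<in> lists ({1..n} \<times> {1..n})"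
      if "v \<in> Poly_Mapping.keys f" "w \<in> Poly_Mapping.keys g" for v w
      using that \<open>f \<in> A\<close> \<open>g \<in> A\<close> unfolding A_def plus_list_def by auto
    then show ?thesis
      using keys_mult[of f g] unfolding A_def by blast
  qed
  have minus: "- f \<in> A" if "f \<in> A" for f
    using that unfolding A_def by simp
  have zero_one: "0 \<in> A" "1 \<in> A"
    unfolding A_def by (auto simp: zero_list_def)
  have fa: "free_algebra n = \<lparr>carrier = A, monoid.mult = (*), one = 1, ring.zero = 0, add = (+)\<rparr>"
    unfolding free_algebra_def A_def ..
  show ?thesis
  proof (rule ringI)
    show "abelian_group (free_algebra n)"
    proof (rule abelian_groupI)
      fix x assume "x \<in> carrier (free_algebra n)"
      then show "\<exists>y\<in>carrier (free_algebra n). y \<oplus>\<^bsub>free_algebra n\<^esub> x = \<zero>\<^bsub>free_algebra n\<^esub>"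
        using minus[of x] by (intro bexI[of _ "- x"]) (auto simp: fa)
    qed (auto simp: fa plus zero_one ac_simps)
    show "monoid (free_algebra n)"
      by (rule monoidI) (auto simp: fa mult zero_one ac_simps)
  qed (auto simp: fa algebra_simps)
qed

definition rs :: "nat \<Rightarrow> nat \<Rightarrow> ncpoly" where
  "rs n i = (\<Sum>\<alpha>=1..n. u i \<alpha>) - 1"

definition cs :: "nat \<Rightarrow> nat \<Rightarrow> ncpoly" where
  "cs n i = (\<Sum>\<alpha>=1..n. u \<alpha> i) - 1"

definition ip :: "nat \<Rightarrow> nat \<Rightarrow> ncpoly" where
  "ip i j = (u i j)^2 - u i j"

definition inj_rel :: "nat \<Rightarrow> nat \<Rightarrow> nat \<Rightarrow> ncpoly" where
  "inj_rel a b c = u a b * u c b"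

definition wel_rel :: "nat \<Rightarrow> nat \<Rightarrow> nat \<Rightarrow> ncpoly" where
  "wel_rel a b c = u a b * u a c"

definition rinj :: "nat \<Rightarrow> nat \<Rightarrow> nat \<Rightarrow> ncpoly" where
  "rinj n j k =
     (\<Sum>\<alpha>=3..n. u j 2 * u k \<alpha>) - (\<Sum>\<alpha>=3..n. u j \<alpha> * u k 1) + u k 1 - u j 2"

definition rwel :: "nat \<Rightarrow> nat \<Rightarrow> nat \<Rightarrow> ncpoly" where
  "rwel n j k =
     (\<Sum>\<alpha>=3..n. u 2 j * u \<alpha> k) - (\<Sum>\<alpha>=3..n. u \<alpha> j * u 1 k) + u 1 k - u 2 j"

definition symmetry_relations :: "nat \<Rightarrow> ncpoly set" where
  "symmetry_relations n =
     {rs n i | i. i \<in> {1..n}} \<union>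
     {cs n i | i. i \<in> {1..n}} \<union>
     {ip i j | i j. i \<in> {1..n} \<and> j \<in> {1..n}} \<union>
     {inj_rel j i k | i j k. i \<in> {1..n} \<and> j \<in> {1..n} \<and> k \<in> {1..n} \<and> j \<noteq> k} \<union>
     {wel_rel i j k | i j k. i \<in> {1..n} \<and> j \<in> {1..n} \<and> k \<in> {1..n} \<and> j \<noteq> k}"

text \<open>The notion \<^const>\<open>ideal\<close> of \<^theory>\<open>HOL-Algebra.Ideal\<close> is that of a two-sided ideal.\<close>

definition qsym_ideal :: "nat \<Rightarrow> ncpoly set" where
  "qsym_ideal n = genideal (free_algebra n) (symmetry_relations n)"

text \<open>Row-wise order of the symbols, with \<open>u\<^sub>1\<^sub>1\<close> the \<^emph>\<open>largest\<close>; \<open>(p, q)\<close> in the relation means \<open>p < q\<close>.\<close>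

definition sym_less :: "((nat \<times> nat) \<times> (nat \<times> nat)) set" where
  "sym_less = {((i, j), (k, l)). k < i \<or> k = i \<and> l < j}"

text \<open>\<^const>\<open>lenlex\<close> compares by length first, then lexicographically from the left.\<close>

definition word_less :: "(word \<times> word) set" where
  "word_less = lenlex sym_less"

text \<open>The value of \<open>lm\<close> at \<open>0\<close> is unspecified.\<close>

definition lm :: "ncpoly \<Rightarrow> word" where
  "lm f = (THE w. w \<in> Poly_Mapping.keys f \<and>
                  (\<forall>v \<in> Poly_Mapping.keys f. v \<noteq> w \<longrightarrow> (v, w) \<in> word_less))"

definition lc :: "ncpoly \<Rightarrow> complex" where
  "lc f = Poly_Mapping.lookup f (lm f)"

text \<open>Divisibility of words, \<open>w = a @ v @ b\<close>, is \<^term>\<open>sublist v w\<close>.\<close>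

definition groebner_basis :: "ncpoly set \<Rightarrow> ncpoly set \<Rightarrow> bool" where
  "groebner_basis G I \<longleftrightarrow>
     G \<subseteq> I \<and> (\<forall>f \<in> I - {0}. \<exists>g \<in> G - {0}. sublist (lm g) (lm f))"

definition reduced :: "ncpoly set \<Rightarrow> bool" where
  "reduced F \<longleftrightarrow> (\<forall>f \<in> F. \<forall>g \<in> F. f \<noteq> g \<longrightarrow> \<not> sublist (lm f) (lm g))"

definition monic :: "ncpoly set \<Rightarrow> bool" where
  "monic F \<longleftrightarrow> (\<forall>f \<in> F. lc f = 1)"

definition qsym_G1 :: "nat \<Rightarrow> ncpoly set" where
  "qsym_G1 n = {cs n 1}"

definition qsym_G2 :: "nat \<Rightarrow> ncpoly set" where
  "qsym_G2 n =
     {cs n i | i. i \<in> {2..n}} \<union>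
     {rs n i | i. i \<in> {2..n}} \<union>
     {ip i j | i j. i \<in> {2..n} \<and> j \<in> {2..n}} \<union>
     {inj_rel i j k | i j k. i \<in> {2..n} \<and> j \<in> {2..n} \<and> k \<in> {2..n} \<and> i \<noteq> k} \<union>
     {wel_rel i j k | i j k. i \<in> {2..n} \<and> j \<in> {2..n} \<and> k \<in> {2..n} \<and> j \<noteq> k} \<union>
     {rinj n k j | j k. j \<in> {2..n} \<and> k \<in> {2..n} \<and> k \<noteq> j} \<union>
     {rwel n k j | j k. j \<in> {2..n} \<and> k \<in> {2..n} \<and> k \<noteq> j \<and> (k, j) \<noteq> (2, 3)}"

definition qsym_G3 :: "nat \<Rightarrow> ncpoly set" where
  "qsym_G3 n =
     {rinj n k j * u i 3 - u k 2 * inj_rel j 3 i | i j k.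
        i \<in> {2..n} \<and> j \<in> {2..n} \<and> k \<in> {2..n} \<and>
        k \<noteq> j \<and> j \<noteq> i \<and> (k, j) \<noteq> (2, 3) \<and> (j, i) \<noteq> (2, 3)}"

definition qsym_G4 :: "nat \<Rightarrow> ncpoly set" where
  "qsym_G4 n =
     {rwel n k j * u 3 i - u 2 k * wel_rel 3 j i | i j k.
        i \<in> {2..n} \<and> j \<in> {2..n} \<and> k \<in> {2..n} \<and>
        k \<noteq> j \<and> j \<noteq> i \<and> (k, j) \<noteq> (2, 3) \<and> (j, i) \<noteq> (2, 3) \<and> (k, j, i) \<noteq> (2, 4, 3)}"

definition qsym_G :: "nat \<Rightarrow> ncpoly set" where
  "qsym_G n = qsym_G1 n \<union> qsym_G2 n \<union> qsym_G3 n \<union> qsym_G4 n"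

end

theory Submission
  imports Defs
begin

text \<open>
  A word in the symbols is a pair of index words of equal length, and a word is normal with respect to
  the claimed leading monomials iff both its row word and its column word have letters in \<open>{2..n}\<close>, no
  two equal neighbours, and neither \<open>23\<close> nor \<open>243\<close> as a subword. That every leading monomial of the
  ideal is non-normal is shown without resolving any overlap, by constructing enough linear
  functionals which vanish on the ideal.

  Let \<open>W\<close> have orthonormal basis \<open>e\<^sub>1, \<dots>, e\<^sub>n\<close>. A family of operators \<open>T\<^sub>m\<close> on the tensor powers
  \<open>W\<^sup>m\<close> which commutes with inserting \<open>\<Sum>e\<^sub>j\<close>, with duplicating a letter, and with the adjoints of these two
  operations gives such a functional: the word with row word \<open>a\<close> and column word \<open>b\<close> is sent to the
  \<open>a\<close>-coordinate of \<open>T\<^sub>m e\<^sub>b\<close>. Given \<open>v', v \<in> W\<^sup>d\<close> killed by both adjoints (cuspidal vectors),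
  the inner products between vectors obtained from \<open>v'\<close> by insertions and duplications agree, up to a
  constant, with those obtained from \<open>v\<close>; so matching these vectors is a multiple of a partial isometry
  \<open>T\<^sub>m\<close>. The resulting functional vanishes on words shorter than \<open>d\<close> and equals
  \<open>v(a) v'(b)\<close>, up to scaling, on words of length \<open>d\<close>.

  Finally, for \<open>n \<ge> 4\<close> every admissible index word is the last word, in lexicographic order, in the
  support of some cuspidal vector; the product of two such vectors isolates the leading coefficient
  of an element of the ideal with normal leading monomial.
\<close>

section \<open>Insertion, duplication and their adjoints on tensor powers\<close>

locale tuple_space =
  fixes n :: nat
begin

text \<open>Tensors in the m-th power of W are represented by functions on all lists, but only their
  values on \<open>tuples m\<close> carry meaning; the \<open>_cong\<close> lemmas below make this
  precise for each operation.\<close>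

definition tuples :: "nat \<Rightarrow> nat list set" where
  "tuples m = {w. length w = m \<and> set w \<subseteq> {1..n}}"

text \<open>Inserts the vector e_1 + ... + e_n at position \<open>p\<close>; in coordinates this
  forgets a letter. For all four operations a position out of range gives 0, so the rules of
  \<open>paired\<close> can be stated for every \<open>p\<close>.\<close>

fun ins :: "nat \<Rightarrow> (nat list \<Rightarrow> real) \<Rightarrow> nat list \<Rightarrow> real" where
  "ins p x [] = 0"
| "ins 0 x (j # w) = x w"
| "ins (Suc p) x (j # w) = ins p (\<lambda>v. x (j # v)) w"

fun del :: "nat \<Rightarrow> (nat list \<Rightarrow> real) \<Rightarrow> nat list \<Rightarrow> real" where
  "del 0 x w = (\<Sum>j=1..n. x (j # w))"
| "del (Suc p) x [] = 0"
| "del (Suc p) x (j # w) = del p (\<lambda>v. x (j # v)) w"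

text \<open>The map from e_j to e_j tensor e_j, applied at position \<open>p\<close>. With
  \<open>mrg\<close> as multiplication, \<open>ins\<close> as unit and \<open>del\<close> as counit
  this is the Frobenius algebra of functions on n points.\<close>

fun dup :: "nat \<Rightarrow> (nat list \<Rightarrow> real) \<Rightarrow> nat list \<Rightarrow> real" where
  "dup p x [] = 0"
| "dup 0 x [i] = 0"
| "dup 0 x (i # j # w) = (if i = j then x (j # w) else 0)"
| "dup (Suc p) x (j # w) = dup p (\<lambda>v. x (j # v)) w"

fun mrg :: "nat \<Rightarrow> (nat list \<Rightarrow> real) \<Rightarrow> nat list \<Rightarrow> real" where
  "mrg p x [] = 0"
| "mrg 0 x (j # w) = x (j # j # w)"
| "mrg (Suc p) x (j # w) = mrg p (\<lambda>v. x (j # v)) w"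

text \<open>The recursion on the length, in place of one sum over \<open>tuples m\<close>, lets
  adjointness and positivity be proved by peeling off the first letter.\<close>

fun inner_on :: "nat \<Rightarrow> (nat list \<Rightarrow> real) \<Rightarrow> (nat list \<Rightarrow> real) \<Rightarrow> real" where
  "inner_on 0 x y = x [] * y []"
| "inner_on (Suc m) x y = (\<Sum>j=1..n. inner_on m (\<lambda>v. x (j # v)) (\<lambda>v. y (j # v)))"

section \<open>Linearity of the operations and their restriction to tuples\<close>

lemma tuples_0 [simp]: "w \<in> tuples 0 \<longleftrightarrow> w = []"
  by (auto simp: tuples_def)

lemma tuples_Nil [simp]: "[] \<in> tuples m \<longleftrightarrow> m = 0"
  by (auto simp: tuples_def)

lemma tuples_Cons [simp]: "j # w \<in> tuples (Suc m) \<longleftrightarrow> j \<in> {1..n} \<and> w \<in> tuples m"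
  by (auto simp: tuples_def)

lemma tuples_SucE:
  assumes "w \<in> tuples (Suc m)"
  obtains j v where "w = j # v" "j \<in> {1..n}" "v \<in> tuples m"
  using assms by (cases w) auto

lemma ins_linear: "ins p (\<lambda>v. a * x v + b * y v) w = a * ins p x w + b * ins p y w"
  by (induction p x w arbitrary: y rule: ins.induct) auto

lemma dup_linear: "dup p (\<lambda>v. a * x v + b * y v) w = a * dup p x w + b * dup p y w"
  by (induction p x w arbitrary: y rule: dup.induct) auto

lemma del_linear: "del p (\<lambda>v. a * x v + b * y v) w = a * del p x w + b * del p y w"
  by (induction p x w arbitrary: y rule: del.induct) (auto simp: sum.distrib sum_distrib_left)

lemma mrg_linear: "mrg p (\<lambda>v. a * x v + b * y v) w = a * mrg p x w + b * mrg p y w"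
  by (induction p x w arbitrary: y rule: mrg.induct) auto

lemma ins_sum: "finite A \<Longrightarrow> ins p (\<lambda>v. \<Sum>k\<in>A. x k v) w = (\<Sum>k\<in>A. ins p (x k) w)"
  by (induction p "\<lambda>v. \<Sum>k\<in>A. x k v" w arbitrary: x rule: ins.induct) auto

lemma dup_sum: "finite A \<Longrightarrow> dup p (\<lambda>v. \<Sum>k\<in>A. x k v) w = (\<Sum>k\<in>A. dup p (x k) w)"
  by (induction p "\<lambda>v. \<Sum>k\<in>A. x k v" w arbitrary: x rule: dup.induct) auto

lemma ins_cong: "(\<And>v. v \<in> tuples m \<Longrightarrow> x v = y v) \<Longrightarrow> w \<in> tuples (Suc m) \<Longrightarrow> ins p x w = ins p y w"
proof (induction p arbitrary: x y w m)
  case 0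
  then show ?case by (cases m) (auto elim!: tuples_SucE)
next
  case (Suc p)
  obtain j v where w: "w = j # v" "j \<in> {1..n}" "v \<in> tuples m"
    using Suc.prems(2) by (rule tuples_SucE)
  show ?case
  proof (cases m)
    case (Suc k)
    have "x (j # v') = y (j # v')" if "v' \<in> tuples k" for v'
      using Suc.prems(1)[of "j # v'"] w that Suc by simp
    then show ?thesis
      using Suc.IH[of k "\<lambda>v. x (j # v)" "\<lambda>v. y (j # v)" v] w Suc by simp
  qed (use w in simp)
qed

lemma dup_cong: "(\<And>v. v \<in> tuples m \<Longrightarrow> x v = y v) \<Longrightarrow> w \<in> tuples (Suc m) \<Longrightarrow> dup p x w = dup p y w"
proof (induction p arbitrary: x y w m)
  case 0
  then show ?case by (cases m) (auto elim!: tuples_SucE)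
next
  case (Suc p)
  obtain j v where w: "w = j # v" "j \<in> {1..n}" "v \<in> tuples m"
    using Suc.prems(2) by (rule tuples_SucE)
  show ?case
  proof (cases m)
    case (Suc k)
    have "x (j # v') = y (j # v')" if "v' \<in> tuples k" for v'
      using Suc.prems(1)[of "j # v'"] w that Suc by simp
    then show ?thesis
      using Suc.IH[of k "\<lambda>v. x (j # v)" "\<lambda>v. y (j # v)" v] w Suc by simp
  qed (use w in simp)
qed

lemma del_cong: "(\<And>v. v \<in> tuples (Suc m) \<Longrightarrow> x v = y v) \<Longrightarrow> w \<in> tuples m \<Longrightarrow> del p x w = del p y w"
proof (induction p arbitrary: x y w m)
  case 0
  then show ?case by (auto intro!: sum.cong)
next
  case (Suc p)
  show ?case
  proof (cases m)
    case (Suc k)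
    then obtain j v where w: "w = j # v" "j \<in> {1..n}" "v \<in> tuples k"
      using Suc.prems(2) by (auto elim: tuples_SucE)
    have "x (j # v') = y (j # v')" if "v' \<in> tuples (Suc k)" for v'
      using Suc.prems(1)[of "j # v'"] w that Suc by simp
    then show ?thesis
      using Suc.IH[of k "\<lambda>v. x (j # v)" "\<lambda>v. y (j # v)" v] w by simp
  qed (use Suc.prems in simp)
qed

lemma mrg_cong: "(\<And>v. v \<in> tuples (Suc m) \<Longrightarrow> x v = y v) \<Longrightarrow> w \<in> tuples m \<Longrightarrow> mrg p x w = mrg p y w"
proof (induction p arbitrary: x y w m)
  case 0
  then show ?case by (cases m) (auto elim!: tuples_SucE)
next
  case (Suc p)
  show ?case
  proof (cases m)
    case (Suc k)
    then obtain j v where w: "w = j # v" "j \<in> {1..n}" "v \<in> tuples k"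
      using Suc.prems(2) by (auto elim: tuples_SucE)
    have "x (j # v') = y (j # v')" if "v' \<in> tuples (Suc k)" for v'
      using Suc.prems(1)[of "j # v'"] w that Suc by simp
    then show ?thesis
      using Suc.IH[of k "\<lambda>v. x (j # v)" "\<lambda>v. y (j # v)" v] w by simp
  qed (use Suc.prems in simp)
qed

section \<open>The inner product and adjointness\<close>

lemma inner_on_commute: "inner_on m x y = inner_on m y x"
  by (induction m arbitrary: x y) auto

lemma inner_on_linear:
  "inner_on m (\<lambda>v. a * x v + b * y v) z = a * inner_on m x z + b * inner_on m y z"
  by (induction m arbitrary: x y z) (auto simp: algebra_simps sum.distrib sum_distrib_left)

lemma inner_on_linear_right:
  "inner_on m z (\<lambda>v. a * x v + b * y v) = a * inner_on m z x + b * inner_on m z y"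
  using inner_on_linear[of m a x b y z] by (simp add: inner_on_commute)

lemma inner_on_sum_right: "finite A \<Longrightarrow> inner_on m z (\<lambda>v. \<Sum>k\<in>A. x k v) = (\<Sum>k\<in>A. inner_on m z (x k))"
proof (induction A rule: finite_induct)
  case empty
  then show ?case using inner_on_linear_right[of m z 0 "\<lambda>_. 0" 0 "\<lambda>_. 0"] by simp
next
  case (insert k A)
  then show ?case using inner_on_linear_right[of m z 1 "x k" 1] by simp
qed

lemma inner_on_cong:
  "(\<And>w. w \<in> tuples m \<Longrightarrow> x w = x' w) \<Longrightarrow> (\<And>w. w \<in> tuples m \<Longrightarrow> y w = y' w) \<Longrightarrow>
    inner_on m x y = inner_on m x' y'"
proof (induction m arbitrary: x x' y y')
  case (Suc m)
  show ?case by (auto intro!: sum.cong Suc)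
qed simp

lemma inner_on_self_nonneg: "inner_on m x x \<ge> 0"
  by (induction m arbitrary: x) (auto intro: sum_nonneg)

lemma inner_on_self_eq_0: "inner_on m x x = 0 \<Longrightarrow> w \<in> tuples m \<Longrightarrow> x w = 0"
proof (induction m arbitrary: x w)
  case (Suc m)
  then obtain j v where w: "w = j # v" "j \<in> {1..n}" "v \<in> tuples m"
    by (auto elim: tuples_SucE)
  have "inner_on m (\<lambda>v. x (j # v)) (\<lambda>v. x (j # v)) = 0"
    using Suc.prems(1) w(2) by (simp add: sum_nonneg_eq_0_iff inner_on_self_nonneg)
  then show ?case
    using Suc.IH[of "\<lambda>v. x (j # v)" v] w by simp
qed auto

lemma inner_on_zero [simp]: "inner_on m x (\<lambda>_. 0) = 0"
  by (induction m arbitrary: x) auto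

text \<open>At position 0 both sides sum out the inserted letter; a larger position is reduced by
  peeling the first letter. Beyond the length of the words both sides vanish.\<close>

lemma inner_on_ins: "inner_on (Suc m) (ins p x) y = inner_on m x (del p y)"
proof (induction p arbitrary: m x y)
  case 0
  have "del 0 y = (\<lambda>w. \<Sum>j=1..n. y (j # w))"
    by (rule ext) simp
  then have "inner_on m x (del 0 y) = (\<Sum>j=1..n. inner_on m x (\<lambda>v. y (j # v)))"
    using inner_on_sum_right[of "{1..n}" m x "\<lambda>j v. y (j # v)"] by simp
  then show ?case by (simp del: del.simps)
next
  case (Suc p)
  show ?case
  proof (cases m)
    case (Suc k)
    show ?thesis
      unfolding Suc inner_on.simps(2)[of "Suc k"]
      by (simp add: Suc.IH del: inner_on.simps(2)) simp
  qed simp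
qed

lemma inner_on_dup: "inner_on (Suc m) (dup p x) y = inner_on m x (mrg p y)"
proof (induction p arbitrary: m x y)
  case 0
  show ?case
  proof (cases m)
    case (Suc k)
    have *: "inner_on k (\<lambda>v. if i = j then x (j # v) else 0) (\<lambda>v. y (i # j # v)) =
      (if i = j then inner_on k (\<lambda>v. x (j # v)) (\<lambda>v. y (j # j # v)) else 0)" for i j
      by (simp add: inner_on_commute[of k "\<lambda>_. 0"])
    show ?thesis
      unfolding Suc by (simp add: *)
  qed simp
next
  case (Suc p)
  show ?case
  proof (cases m)
    case (Suc k)
    show ?thesis
      unfolding Suc inner_on.simps(2)[of "Suc k"]
      by (simp add: Suc.IH del: inner_on.simps(2)) simp
  qed simp
qed

section \<open>Moving an adjoint past an insertion or a duplication\<close>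

lemma del_ins_same: "w \<in> tuples m \<Longrightarrow> p \<le> m \<Longrightarrow> del p (ins p x) w = real n * x w"
proof (induction p arbitrary: x w m)
  case (Suc p)
  then show ?case by (cases m) (auto elim!: tuples_SucE)
qed simp

text \<open>Operations at different places commute up to a shift of position by one. This is the
  source of \<open>p - 1\<close> here and of \<open>q - 1\<close> in the variants ending in
  \<open>_greater\<close>.\<close>

lemma del_ins_less: "q < p \<Longrightarrow> del q (ins p x) w = ins (p - 1) (del q x) w"
proof (induction q arbitrary: p x w)
  case 0
  then obtain p' where p: "p = Suc p'" by (cases p) auto
  show ?case
    unfolding p using ins_sum[of "{1..n}" p' "\<lambda>j v. x (j # v)" w] by simp
next
  case (Suc q)
  then obtain p' where "p = Suc (Suc p')" using that[of "p - 2"] by simp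
  then show ?case using Suc by (cases w) auto
qed

lemma del_ins_greater: "p < q \<Longrightarrow> del q (ins p x) w = ins p (del (q - 1) x) w"
proof (induction p arbitrary: q x w)
  case 0
  then show ?case by (cases q; cases w) auto
next
  case (Suc p)
  then obtain q' where "q = Suc (Suc q')" using that[of "q - 2"] by simp
  then show ?case using Suc by (cases w) auto
qed

text \<open>The counit law, on one of the two copies; \<open>mrg_ins_same\<close> and
  \<open>mrg_ins_Suc\<close> below are the adjoint unit laws.\<close>

lemma del_dup_same: "w \<in> tuples m \<Longrightarrow> p < m \<Longrightarrow> del p (dup p x) w = x w"
proof (induction p arbitrary: x w m)
  case 0
  then obtain j v where "w = j # v" "j \<in> {1..n}" by (cases m) (auto elim!: tuples_SucE)
  then show ?case by simp
next
  case (Suc p)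
  then show ?case by (cases m) (auto elim!: tuples_SucE)
qed

lemma del_Suc_dup: "w \<in> tuples m \<Longrightarrow> p < m \<Longrightarrow> del (Suc p) (dup p x) w = x w"
proof (induction p arbitrary: x w m)
  case 0
  then obtain j v where "w = j # v" "j \<in> {1..n}" by (cases m) (auto elim!: tuples_SucE)
  then show ?case by simp
next
  case (Suc p)
  then show ?case by (cases m) (auto elim!: tuples_SucE)
qed

lemma del_dup_less: "q < p \<Longrightarrow> del q (dup p x) w = dup (p - 1) (del q x) w"
proof (induction q arbitrary: p x w)
  case 0
  then obtain p' where p: "p = Suc p'" by (cases p) auto
  show ?case
    unfolding p using dup_sum[of "{1..n}" p' "\<lambda>j v. x (j # v)" w] by simp
next
  case (Suc q)
  then obtain p' where "p = Suc (Suc p')" using that[of "p - 2"] by simp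
  then show ?case using Suc by (cases w) auto
qed

lemma del_zero [simp]: "del q (\<lambda>v. 0) w = 0"
  using del_linear[of q 0 "\<lambda>_. 0" 0 "\<lambda>_. 0" w] by simp

lemma del_dup_greater: "Suc p < q \<Longrightarrow> del q (dup p x) w = dup p (del (q - 1) x) w"
proof (induction p arbitrary: q x w)
  case 0
  then obtain q' where q: "q = Suc (Suc q')" using that[of "q - 2"] by simp
  show ?case unfolding q
    by (cases w rule: remdups_adj.cases) auto
next
  case (Suc p)
  then obtain q' where "q = Suc (Suc q')" using that[of "q - 2"] by simp
  then show ?case using Suc by (cases w) auto
qed

lemma mrg_ins_same: "w \<in> tuples m \<Longrightarrow> p < m \<Longrightarrow> mrg p (ins p x) w = x w"
proof (induction p arbitrary: x w m)
  case 0
  then show ?case by (cases m) (auto elim!: tuples_SucE)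
next
  case (Suc p)
  then show ?case by (cases m) (auto elim!: tuples_SucE)
qed

lemma mrg_ins_Suc: "w \<in> tuples m \<Longrightarrow> p < m \<Longrightarrow> mrg p (ins (Suc p) x) w = x w"
proof (induction p arbitrary: x w m)
  case 0
  then show ?case by (cases m) (auto elim!: tuples_SucE)
next
  case (Suc p)
  then show ?case by (cases m) (auto elim!: tuples_SucE)
qed

lemma mrg_ins_less: "Suc q < p \<Longrightarrow> mrg q (ins p x) w = ins (p - 1) (mrg q x) w"
proof (induction q arbitrary: p x w)
  case 0
  then obtain p' where p: "p = Suc (Suc p')" using that[of "p - 2"] by simp
  show ?case
    unfolding p by (cases w) simp_all
next
  case (Suc q)
  then obtain p' where "p = Suc (Suc p')" using that[of "p - 2"] by simp
  then show ?case using Suc by (cases w) auto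
qed

lemma mrg_ins_greater: "p < q \<Longrightarrow> mrg q (ins p x) w = ins p (mrg (q - 1) x) w"
proof (induction p arbitrary: q x w)
  case 0
  then show ?case by (cases q; cases w) auto
next
  case (Suc p)
  then obtain q' where "q = Suc (Suc q')" using that[of "q - 2"] by simp
  then show ?case using Suc by (cases w) auto
qed

lemma mrg_dup_same: "w \<in> tuples m \<Longrightarrow> p < m \<Longrightarrow> mrg p (dup p x) w = x w"
proof (induction p arbitrary: x w m)
  case 0
  then show ?case by (cases m) (auto elim!: tuples_SucE)
next
  case (Suc p)
  then show ?case by (cases m) (auto elim!: tuples_SucE)
qed

lemma mrg_dup_less: "q < p \<Longrightarrow> mrg q (dup p x) w = dup (p - 1) (mrg q x) w"
proof (induction q arbitrary: p x w)
  case 0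
  then obtain p' where p: "p = Suc p'" by (cases p) auto
  show ?case
    unfolding p by (cases p'; cases w rule: remdups_adj.cases) auto
next
  case (Suc q)
  then obtain p' where "p = Suc (Suc p')" using that[of "p - 2"] by simp
  then show ?case using Suc by (cases w) auto
qed

lemma mrg_zero [simp]: "mrg q (\<lambda>v. 0) w = 0"
  using mrg_linear[of q 0 "\<lambda>_. 0" 0 "\<lambda>_. 0" w] by simp

text \<open>The adjacent case \<open>q = Suc p\<close> is the Frobenius relation between duplication
  and merging; it has the same shape as the commutation of distant operations.\<close>

lemma mrg_dup_greater: "p < q \<Longrightarrow> mrg q (dup p x) w = dup p (mrg (q - 1) x) w"
proof (induction p arbitrary: q x w)
  case 0
  then obtain q' where q: "q = Suc q'" by (cases q) auto
  show ?case
    unfolding q by (cases q'; cases w rule: remdups_adj.cases) auto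
next
  case (Suc p)
  then obtain q' where "q = Suc (Suc q')" using that[of "q - 2"] by simp
  then show ?case using Suc by (cases w) auto
qed

lemma ins_beyond: "w \<in> tuples (Suc m) \<Longrightarrow> m < p \<Longrightarrow> ins p x w = 0"
proof (induction p arbitrary: x w m)
  case (Suc p)
  then show ?case by (cases m) (auto elim!: tuples_SucE)
qed simp

lemma dup_beyond: "w \<in> tuples (Suc m) \<Longrightarrow> m \<le> p \<Longrightarrow> dup p x w = 0"
proof (induction p arbitrary: x w m)
  case 0
  then show ?case by (cases m) (auto elim!: tuples_SucE)
next
  case (Suc p)
  then show ?case by (cases m) (auto elim!: tuples_SucE)
qed

lemma del_beyond: "w \<in> tuples m \<Longrightarrow> m < p \<Longrightarrow> del p x w = 0"
proof (induction p arbitrary: x w m)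
  case (Suc p)
  then show ?case by (cases m) (auto elim!: tuples_SucE)
qed simp

lemma mrg_beyond: "w \<in> tuples m \<Longrightarrow> m \<le> p \<Longrightarrow> mrg p x w = 0"
proof (induction p arbitrary: x w m)
  case 0
  then show ?case by (cases m) (auto elim!: tuples_SucE)
next
  case (Suc p)
  then show ?case by (cases m) (auto elim!: tuples_SucE)
qed

lemma ins_zero: "w \<in> tuples (Suc m) \<Longrightarrow> (\<And>w. w \<in> tuples m \<Longrightarrow> x w = 0) \<Longrightarrow> ins p x w = 0"
  using ins_cong[of m x "\<lambda>_. 0" w p] ins_linear[of p 0 "\<lambda>_. 0" 0 "\<lambda>_. 0" w] by simp

lemma dup_zero: "w \<in> tuples (Suc m) \<Longrightarrow> (\<And>w. w \<in> tuples m \<Longrightarrow> x w = 0) \<Longrightarrow> dup p x w = 0"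
  using dup_cong[of m x "\<lambda>_. 0" w p] dup_linear[of p 0 "\<lambda>_. 0" 0 "\<lambda>_. 0" w] by simp

section \<open>Basis vectors and the operations on them\<close>

lemma finite_tuples: "finite (tuples m)"
proof -
  have "tuples m = {w. set w \<subseteq> {1..n} \<and> length w = m}" by (auto simp: tuples_def)
  then show ?thesis by (simp add: finite_lists_length_eq)
qed

definition basis_vector :: "nat list \<Rightarrow> nat list \<Rightarrow> real" where
  "basis_vector b w = (if w = b then 1 else 0)"

lemma inner_on_basis_vector: "b \<in> tuples m \<Longrightarrow> inner_on m (basis_vector b) y = y b"
proof (induction m arbitrary: b y)
  case 0
  then show ?case by (simp add: basis_vector_def)
next
  case (Suc m)
  then obtain j w where b: "b = j # w" "j \<in> {1..n}" "w \<in> tuples m" by (auto elim: tuples_SucE)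
  have "inner_on m (\<lambda>v. basis_vector b (i # v)) (\<lambda>v. y (i # v)) = (if i = j then y (j # w) else 0)" for i
  proof (cases "i = j")
    case True
    then have "(\<lambda>v. basis_vector b (i # v)) = basis_vector w" by (auto simp: basis_vector_def b(1))
    then show ?thesis using True Suc.IH[OF b(3)] by simp
  next
    case False
    then have "(\<lambda>v. basis_vector b (i # v)) = (\<lambda>_. 0)" by (auto simp: basis_vector_def b(1))
    then show ?thesis using False by (simp add: inner_on_commute[of m "\<lambda>_. 0"])
  qed
  then have "inner_on (Suc m) (basis_vector b) y = (\<Sum>i=1..n. if i = j then y (j # w) else 0)"
    by simp
  then show ?case using b by (simp del: inner_on.simps)
qed

text \<open>Here and in the next three lemmas the position is given by a prefix \<open>s\<close>,
  the form in which a relation is applied in the middle of a word.\<close>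

lemma ins_split: "ins (length s) x (s @ i # t) = x (s @ t)"
  by (induction s arbitrary: x) auto

lemma dup_split: "dup (length s) x (s @ i # j # t) = (if i = j then x (s @ j # t) else 0)"
  by (induction s arbitrary: x) auto

lemma del_split: "del (length s) x (s @ t) = (\<Sum>j=1..n. x (s @ j # t))"
  by (induction s arbitrary: x) auto

lemma mrg_split: "mrg (length s) x (s @ j # t) = x (s @ j # j # t)"
  by (induction s arbitrary: x) auto

lemma tuples_splitE:
  assumes "w \<in> tuples m" "k \<le> m"
  obtains s t where "w = s @ t" "length s = k" "length t = m - k"
  using assms that[of "take k w" "drop k w"] by (simp add: tuples_def min_def)

lemma ins_basis_vector:
  assumes "w \<in> tuples (Suc (length s + length t))"
  shows "ins (length s) (basis_vector (s @ t)) w = (\<Sum>j=1..n. basis_vector (s @ j # t) w)"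
proof -
  obtain s' t' where w: "w = s' @ t'" "length s' = length s" "length t' = Suc (length t)"
    using tuples_splitE[OF assms, of "length s"] by auto
  then obtain i t'' where t': "t' = i # t''" by (cases t') auto
  have "i \<in> {1..n}" using assms by (auto simp: w t' tuples_def)
  then show ?thesis
    using w by (simp add: ins_split[of s', unfolded w(2)] t' basis_vector_def if_distrib sum.If_cases)
      (auto simp: Int_def)
qed

lemma del_basis_vector:
  assumes "w \<in> tuples (length s + length t)" "j \<in> {1..n}"
  shows "del (length s) (basis_vector (s @ j # t)) w = basis_vector (s @ t) w"
proof -
  obtain s' t' where w: "w = s' @ t'" "length s' = length s" "length t' = length t"
    using tuples_splitE[OF assms(1), of "length s"] by auto
  have "del (length s) (basis_vector (s @ j # t)) w = (\<Sum>j'=1..n. if j' = j then basis_vector (s @ t) w else 0)"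
    using w by (auto simp: del_split[of s', unfolded w(2)] basis_vector_def intro!: sum.cong)
  then show ?thesis using assms(2) by simp
qed

lemma dup_basis_vector:
  assumes "w \<in> tuples (Suc (Suc (length s + length t)))"
  shows "dup (length s) (basis_vector (s @ j # t)) w = basis_vector (s @ j # j # t) w"
proof -
  obtain s' t' where w: "w = s' @ t'" "length s' = length s" "length t' = Suc (Suc (length t))"
    using tuples_splitE[OF assms, of "length s"] by auto
  then obtain i i' t'' where t': "t' = i # i' # t''" by (metis length_Suc_conv)
  show ?thesis
    using w by (auto simp: dup_split[of s', unfolded w(2)] t' basis_vector_def)
qed

lemma mrg_basis_vector:
  assumes "w \<in> tuples (Suc (length s + length t))"
  shows "mrg (length s) (basis_vector (s @ j # k # t)) w = (if j = k then basis_vector (s @ j # t) w else 0)"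
proof -
  obtain s' t' where w: "w = s' @ t'" "length s' = length s" "length t' = Suc (length t)"
    using tuples_splitE[OF assms, of "length s"] by auto
  then obtain i t'' where t': "t' = i # t''" by (metis length_Suc_conv)
  show ?thesis
    using w by (auto simp: mrg_split[of s', unfolded w(2)] t' basis_vector_def)
qed

end

section \<open>Operators which commute with insertion and duplication\<close>

text \<open>Phrased with \<open>d = Suc m\<close>, the vanishing conditions are empty for d = 0.
  Only \<open>v'\<close> is required to be nonzero, because its squared norm becomes a
  denominator.\<close>

locale cuspidal_pair = tuple_space +
  fixes d :: nat and v v' :: "nat list \<Rightarrow> real"
  assumes del_v: "\<And>q m w. d = Suc m \<Longrightarrow> w \<in> tuples m \<Longrightarrow> del q v w = 0"
    and del_v': "\<And>q m w. d = Suc m \<Longrightarrow> w \<in> tuples m \<Longrightarrow> del q v' w = 0"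
    and mrg_v: "\<And>q m w. d = Suc m \<Longrightarrow> w \<in> tuples m \<Longrightarrow> mrg q v w = 0"
    and mrg_v': "\<And>q m w. d = Suc m \<Longrightarrow> w \<in> tuples m \<Longrightarrow> mrg q v' w = 0"
    and v'_pos: "inner_on d v' v' > 0"
begin

text \<open>The linear relation spanned by applying the same string of insertions and duplications
  to \<open>v'\<close> and to \<open>v\<close>. It turns out to be the graph of a linear map from
  first to second components.\<close>

inductive paired :: "nat \<Rightarrow> (nat list \<Rightarrow> real) \<Rightarrow> (nat list \<Rightarrow> real) \<Rightarrow> bool" where
  base: "paired d v' v"
| ins: "paired m x y \<Longrightarrow> paired (Suc m) (ins p x) (ins p y)"
| dup: "paired m x y \<Longrightarrow> paired (Suc m) (dup p x) (dup p y)"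
| zero: "paired m (\<lambda>_. 0) (\<lambda>_. 0)"
| linear: "paired m x y \<Longrightarrow> paired m x' y' \<Longrightarrow>
    paired m (\<lambda>w. a * x w + b * x' w) (\<lambda>w. a * y w + b * y' w)"
| congr: "paired m x y \<Longrightarrow> (\<And>w. w \<in> tuples m \<Longrightarrow> x' w = x w) \<Longrightarrow>
    (\<And>w. w \<in> tuples m \<Longrightarrow> y' w = y w) \<Longrightarrow> paired m x' y'"

lemma paired_scale: "paired m x y \<Longrightarrow> paired m (\<lambda>w. a * x w) (\<lambda>w. a * y w)"
  using paired.linear[of m x y "\<lambda>_. 0" "\<lambda>_. 0" a 0] by (simp add: paired.zero)

lemma paired_null:
  "(\<And>w. w \<in> tuples m \<Longrightarrow> x w = 0) \<Longrightarrow> (\<And>w. w \<in> tuples m \<Longrightarrow> y w = 0) \<Longrightarrow> paired m x y"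
  by (rule paired.congr[OF paired.zero]) auto

text \<open>An adjoint moves inwards until it cancels against an insertion or duplication, or
  reaches \<open>v'\<close> and \<open>v\<close>, which it kills. Scalars and positions depend only
  on the string of operations, hence agree in both components.\<close>

lemma paired_del_mrg:
  "paired m x y \<Longrightarrow> m = Suc k \<Longrightarrow>
    paired k (del q x) (del q y) \<and> paired k (mrg q x) (mrg q y)"
proof (induction arbitrary: k q rule: paired.induct)
  case base
  show ?case
    by (intro conjI paired_null)
       (fact del_v[OF base] del_v'[OF base] mrg_v[OF base] mrg_v'[OF base])+
next
  case (ins m x y p)
  have k: "k = m" using ins.prems by simp
  have "paired m (del q (ins p x)) (del q (ins p y))"
  proof -
    consider "q > m" | "p > m" | "q = p" "p \<le> m" | "q < p" "p \<le> m" | "p < q" "q \<le> m" by linarith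
    then show ?thesis
    proof cases
      case 1
      then show ?thesis by (auto intro!: paired_null del_beyond)
    next
      case 2
      then have "del q (ins p x) w = 0" if "w \<in> tuples m" for w x
        using that del_cong[of m "ins p x" "\<lambda>_. 0" w q] by (simp add: ins_beyond)
      then show ?thesis by (auto intro!: paired_null)
    next
      case 3
      then show ?thesis
        by (intro paired.congr[OF paired_scale[OF ins.hyps, of "real n"]]) (auto simp: del_ins_same)
    next
      case 4
      then obtain m' where "m = Suc m'" by (cases m) auto
      with 4 ins.IH[of m' q] show ?thesis
        by (auto intro: paired.congr[OF paired.ins[of m' _ _ "p - 1"]] simp: del_ins_less)
    next
      case 5
      then obtain m' where "m = Suc m'" by (cases m) auto
      with 5 ins.IH[of m' "q - 1"] show ?thesis
        by (auto intro: paired.congr[OF paired.ins[of m' _ _ p]] simp: del_ins_greater)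
    qed
  qed
  moreover have "paired m (mrg q (ins p x)) (mrg q (ins p y))"
  proof -
    consider "q \<ge> m" | "p > m" | "q = p" "q < m" | "p = Suc q" "q < m"
      | "Suc q < p" "q < m" "p \<le> m" | "p < q" "q < m" by linarith
    then show ?thesis
    proof cases
      case 1
      then show ?thesis by (auto intro!: paired_null mrg_beyond)
    next
      case 2
      then have "mrg q (ins p x) w = 0" if "w \<in> tuples m" for w x
        using that mrg_cong[of m "ins p x" "\<lambda>_. 0" w q] by (simp add: ins_beyond)
      then show ?thesis by (auto intro!: paired_null)
    next
      case 3
      then show ?thesis
        by (intro paired.congr[OF ins.hyps]) (auto simp: mrg_ins_same)
    next
      case 4
      then show ?thesis
        by (intro paired.congr[OF ins.hyps]) (auto simp: mrg_ins_Suc)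
    next
      case 5
      then obtain m' where "m = Suc m'" by (cases m) auto
      with 5 ins.IH[of m' q] show ?thesis
        by (auto intro: paired.congr[OF paired.ins[of m' _ _ "p - 1"]] simp: mrg_ins_less)
    next
      case 6
      then obtain m' where "m = Suc m'" by (cases m) auto
      with 6 ins.IH[of m' "q - 1"] show ?thesis
        by (auto intro: paired.congr[OF paired.ins[of m' _ _ p]] simp: mrg_ins_greater)
    qed
  qed
  ultimately show ?case unfolding k ..
next
  case (dup m x y p)
  have k: "k = m" using dup.prems by simp
  have "paired m (del q (dup p x)) (del q (dup p y))"
  proof -
    consider "q > m" | "p \<ge> m" | "q = p" "p < m" | "q = Suc p" "p < m"
      | "q < p" "p < m" | "Suc p < q" "q \<le> m" by linarith
    then show ?thesis
    proof cases
      case 1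
      then show ?thesis by (auto intro!: paired_null del_beyond)
    next
      case 2
      then have "del q (dup p x) w = 0" if "w \<in> tuples m" for w x
        using that del_cong[of m "dup p x" "\<lambda>_. 0" w q] by (simp add: dup_beyond)
      then show ?thesis by (auto intro!: paired_null)
    next
      case 3
      then show ?thesis
        by (intro paired.congr[OF dup.hyps]) (auto simp: del_dup_same)
    next
      case 4
      then show ?thesis
        by (intro paired.congr[OF dup.hyps]) (auto simp: del_Suc_dup)
    next
      case 5
      then obtain m' where "m = Suc m'" by (cases m) auto
      with 5 dup.IH[of m' q] show ?thesis
        by (auto intro: paired.congr[OF paired.dup[of m' _ _ "p - 1"]] simp: del_dup_less)
    next
      case 6
      then obtain m' where "m = Suc m'" by (cases m) auto
      with 6 dup.IH[of m' "q - 1"] show ?thesis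
        by (auto intro: paired.congr[OF paired.dup[of m' _ _ p]] simp: del_dup_greater)
    qed
  qed
  moreover have "paired m (mrg q (dup p x)) (mrg q (dup p y))"
  proof -
    consider "q \<ge> m" | "p \<ge> m" | "q = p" "q < m"
      | "q < p" "p < m" | "p < q" "q < m" by linarith
    then show ?thesis
    proof cases
      case 1
      then show ?thesis by (auto intro!: paired_null mrg_beyond)
    next
      case 2
      then have "mrg q (dup p x) w = 0" if "w \<in> tuples m" for w x
        using that mrg_cong[of m "dup p x" "\<lambda>_. 0" w q] by (simp add: dup_beyond)
      then show ?thesis by (auto intro!: paired_null)
    next
      case 3
      then show ?thesis
        by (intro paired.congr[OF dup.hyps]) (auto simp: mrg_dup_same)
    next
      case 4
      then obtain m' where "m = Suc m'" by (cases m) auto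
      with 4 dup.IH[of m' q] show ?thesis
        by (auto intro: paired.congr[OF paired.dup[of m' _ _ "p - 1"]] simp: mrg_dup_less)
    next
      case 5
      then obtain m' where "m = Suc m'" by (cases m) auto
      with 5 dup.IH[of m' "q - 1"] show ?thesis
        by (auto intro: paired.congr[OF paired.dup[of m' _ _ p]] simp: mrg_dup_greater)
    qed
  qed
  ultimately show ?case unfolding k ..
next
  case (zero m)
  then show ?case by (auto intro!: paired_null)
next
  case (linear m x y x' y' a b)
  have "paired k (\<lambda>w. a * del q x w + b * del q x' w) (\<lambda>w. a * del q y w + b * del q y' w)"
    "paired k (\<lambda>w. a * mrg q x w + b * mrg q x' w) (\<lambda>w. a * mrg q y w + b * mrg q y' w)"
    using linear.IH[OF linear.prems] by (intro paired.linear; simp)+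
  moreover have "del q (\<lambda>w. a * f w + b * g w) = (\<lambda>w. a * del q f w + b * del q g w)"
    "mrg q (\<lambda>w. a * f w + b * g w) = (\<lambda>w. a * mrg q f w + b * mrg q g w)" for f g
    by (rule ext, rule del_linear mrg_linear)+
  ultimately show ?case by simp
next
  case (congr m x y x' y')
  then have "paired k (del q x) (del q y)" "paired k (mrg q x) (mrg q y)" by auto
  moreover have "del q x' w = del q x w" "del q y' w = del q y w"
    "mrg q x' w = mrg q x w" "mrg q y' w = mrg q y w" if "w \<in> tuples k" for w
    using congr.hyps(2,3) congr.prems that by (auto intro: del_cong mrg_cong)
  ultimately show ?case by (blast intro: paired.congr)
qed

lemma paired_del: "paired (Suc k) x y \<Longrightarrow> paired k (del q x) (del q y)"
  and paired_mrg: "paired (Suc k) x y \<Longrightarrow> paired k (mrg q x) (mrg q y)"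
  using paired_del_mrg by blast+

text \<open>Pairs originate in degree \<open>d\<close> and the operations only raise the
  degree.\<close>

lemma paired_below: "paired m x y \<Longrightarrow> m < d \<Longrightarrow> w \<in> tuples m \<Longrightarrow> x w = 0 \<and> y w = 0"
  by (induction arbitrary: w rule: paired.induct) (auto intro!: ins_zero dup_zero)

text \<open>An insertion or duplication landing in degree \<open>d\<close> starts one degree lower,
  where only zero pairs exist; what remains are multiples of the original pair.\<close>

lemma paired_at: "paired m x y \<Longrightarrow> m = d \<Longrightarrow> \<exists>c. \<forall>w\<in>tuples d. x w = c * v' w \<and> y w = c * v w"
proof (induction rule: paired.induct)
  case base
  then show ?case by (intro exI[of _ 1]) auto
next
  case (ins m x y p)
  have "ins p x w = 0 \<and> ins p y w = 0" if "w \<in> tuples d" for w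
    using that ins paired_below[OF ins.hyps] by (auto intro!: ins_zero[of w m])
  then show ?case by (intro exI[of _ 0]) auto
next
  case (dup m x y p)
  have "dup p x w = 0 \<and> dup p y w = 0" if "w \<in> tuples d" for w
    using that dup paired_below[OF dup.hyps] by (auto intro!: dup_zero[of w m])
  then show ?case by (intro exI[of _ 0]) auto
next
  case (zero m)
  then show ?case by (intro exI[of _ 0]) auto
next
  case (linear m x y x' y' a b)
  then obtain c c' where "\<forall>w\<in>tuples d. x w = c * v' w \<and> y w = c * v w"
    "\<forall>w\<in>tuples d. x' w = c' * v' w \<and> y' w = c' * v w" by blast
  then show ?case by (intro exI[of _ "a * c + b * c'"]) (auto simp: algebra_simps)
next
  case (congr m x y x' y')
  then show ?case by auto
qed

text \<open>An insertion or duplication in the first pair is moved over to the second pair as an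
  adjoint, under which pairs are closed; in degree \<open>d\<close> the claim follows from
  \<open>paired_at\<close>. Thus passing from x to y multiplies all inner products by one
  constant.\<close>

lemma paired_inner:
  "paired m x y \<Longrightarrow> paired m x2 y2 \<Longrightarrow>
    inner_on d v' v' * inner_on m y y2 = inner_on d v v * inner_on m x x2"
proof (induction arbitrary: x2 y2 rule: paired.induct)
  case base
  obtain c where c: "\<And>w. w \<in> tuples d \<Longrightarrow> x2 w = c * v' w" "\<And>w. w \<in> tuples d \<Longrightarrow> y2 w = c * v w"
    using paired_at[OF base] by blast
  have "inner_on d v y2 = c * inner_on d v v"
    using inner_on_cong[of d v v y2 "\<lambda>w. c * v w"] inner_on_linear_right[of d v c v 0 "\<lambda>_. 0"] c by simp
  moreover have "inner_on d v' x2 = c * inner_on d v' v'"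
    using inner_on_cong[of d v' v' x2 "\<lambda>w. c * v' w"] inner_on_linear_right[of d v' c v' 0 "\<lambda>_. 0"] c by simp
  ultimately show ?case by simp
next
  case (ins m x y p)
  then show ?case unfolding inner_on_ins by (blast intro: paired_del)
next
  case (dup m x y p)
  then show ?case unfolding inner_on_dup by (blast intro: paired_mrg)
next
  case (zero m)
  then show ?case by (simp add: inner_on_commute[of m "\<lambda>_. 0"])
next
  case (linear m x y x' y' a b)
  from linear.IH[OF linear.prems] show ?case
    by (simp add: inner_on_linear distrib_left mult.left_commute)
next
  case (congr m x y x' y')
  have "inner_on m x' x2 = inner_on m x x2" "inner_on m y' y2 = inner_on m y y2"
    using congr.hyps by (auto intro!: inner_on_cong)
  then show ?case using congr.IH[OF congr.prems] by simp
qed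

text \<open>If x has norm 0, so has y: the second component is determined by the first.\<close>

lemma paired_zero:
  assumes "paired m x y" "\<And>w. w \<in> tuples m \<Longrightarrow> x w = 0" "w \<in> tuples m"
  shows "y w = 0"
proof -
  have "inner_on m x x = 0"
    using inner_on_cong[of m x "\<lambda>_. 0" x x] assms(2) by (simp add: inner_on_commute[of m "\<lambda>_. 0"])
  then have "inner_on m y y = 0"
    using paired_inner[OF assms(1) assms(1)] v'_pos by simp
  then show ?thesis using inner_on_self_eq_0 assms(3) by blast
qed

text \<open>Orthogonal projection onto the first components, by a Gram-Schmidt process over the
  coordinates \<open>A\<close> in which they may be nonzero. The second component is carried along,
  so that the projection comes with its partner.\<close>

lemma paired_projection:
  assumes "finite A" "A \<subseteq> tuples m"
    and "\<And>x y. Q x y \<Longrightarrow> paired m x y"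
    and "\<And>x y x' y' a b. Q x y \<Longrightarrow> Q x' y' \<Longrightarrow> Q (\<lambda>w. a * x w + b * x' w) (\<lambda>w. a * y w + b * y' w)"
    and "Q (\<lambda>_. 0) (\<lambda>_. 0)"
    and "\<And>x y w. Q x y \<Longrightarrow> w \<in> tuples m - A \<Longrightarrow> x w = 0"
  shows "\<exists>x y. Q x y \<and> (\<forall>x' y'. Q x' y' \<longrightarrow> inner_on m e x' = inner_on m x x')"
  using assms
proof (induction A arbitrary: Q e rule: finite_induct)
  case empty
  have "inner_on m e x' = inner_on m (\<lambda>_. 0) x'" if "Q x' y'" for x' y'
    using inner_on_cong[of m e e x' "\<lambda>_. 0"] empty(5)[OF that]
    by (simp add: inner_on_commute[of m "\<lambda>_. 0"])
  with empty(4) show ?case by blast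
next
  case (insert a A)
  \<comment> \<open>The subspace of \<open>Q\<close> where coordinate \<open>a\<close> vanishes; its
    first components are supported on the smaller set, so the induction hypothesis applies.\<close>
  define Q' where "Q' x y \<longleftrightarrow> Q x y \<and> x a = 0" for x y
  have proj: "\<exists>x y. Q' x y \<and> (\<forall>x' y'. Q' x' y' \<longrightarrow> inner_on m e x' = inner_on m x x')" for e
  proof (rule insert.IH)
    show "Q' (\<lambda>w. a * x w + b * x' w) (\<lambda>w. a * y w + b * y' w)"
      if "Q' x y" "Q' x' y'" for x y x' y' a b
      using that insert.prems(3) unfolding Q'_def by auto
    show "x w = 0" if "Q' x y" "w \<in> tuples m - A" for x y w
      using that insert.prems(5)[of x y w] unfolding Q'_def by (cases "w = a") auto
  qed (use insert.prems in \<open>auto simp: Q'_def\<close>)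
  show ?case
  proof (cases "\<exists>x y. Q x y \<and> x a \<noteq> 0")
    case False
    then have "Q' = Q" by (auto simp: Q'_def fun_eq_iff)
    with proj show ?thesis by simp
  next
    case True
    then obtain x0 y0 where b: "Q x0 y0" "x0 a \<noteq> 0" by blast
    obtain x1 y1 where p1: "Q' x1 y1" "\<And>x' y'. Q' x' y' \<Longrightarrow> inner_on m x0 x' = inner_on m x1 x'"
      using proj[of x0] by blast
    \<comment> \<open>The component of \<open>x0\<close> orthogonal to \<open>Q'\<close>. First
      components of \<open>Q\<close> are those of \<open>Q'\<close> plus multiples of
      \<open>xb\<close>, so \<open>e\<close> is projected onto both summands separately.\<close>
    define xb where "xb w = 1 * x0 w + (- 1) * x1 w" for w
    define yb where "yb w = 1 * y0 w + (- 1) * y1 w" for w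
    have Qb: "Q xb yb" using insert.prems(3) b(1) p1(1) unfolding xb_def yb_def Q'_def by blast
    have xba: "xb a \<noteq> 0" using p1(1) b(2) by (simp add: xb_def Q'_def)
    have orth: "inner_on m xb x' = 0" if "Q' x' y'" for x' y'
      unfolding xb_def inner_on_linear using p1(2)[OF that] by simp
    have pos: "inner_on m xb xb \<noteq> 0"
      using inner_on_self_eq_0 xba insert.prems(1) by blast
    obtain x2 y2 where p2: "Q' x2 y2" "\<And>x' y'. Q' x' y' \<Longrightarrow> inner_on m e x' = inner_on m x2 x'"
      using proj[of e] by blast
    define c where "c = inner_on m e xb / inner_on m xb xb"
    define x where "x w = 1 * x2 w + c * xb w" for w
    define y where "y w = 1 * y2 w + c * yb w" for w
    have "Q x y" using insert.prems(3) p2(1) Qb unfolding x_def y_def Q'_def by blast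
    moreover have "inner_on m e x' = inner_on m x x'" if "Q x' y'" for x' y'
    proof -
      define t where "t = x' a / xb a"
      define z where "z w = 1 * x' w + (- t) * xb w" for w
      have z: "Q' z (\<lambda>w. 1 * y' w + (- t) * yb w)"
        using insert.prems(3)[OF that Qb, of 1 "- t"] xba unfolding Q'_def z_def t_def by simp
      have x': "x' = (\<lambda>w. 1 * z w + t * xb w)" by (simp add: z_def fun_eq_iff)
      have "inner_on m e x' = inner_on m e z + t * inner_on m e xb"
        unfolding x' inner_on_linear_right by simp
      moreover have "inner_on m x x' = inner_on m x2 z + t * inner_on m x2 xb
          + c * (inner_on m xb z + t * inner_on m xb xb)"
        unfolding x' x_def inner_on_linear_right inner_on_linear by (simp add: algebra_simps)
      moreover have "inner_on m x2 xb = 0" using orth[OF p2(1)] inner_on_commute by metis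
      ultimately show ?thesis using p2(2)[OF z] orth[OF z] pos by (simp add: c_def)
    qed
    ultimately show ?thesis by blast
  qed
qed

text \<open>
  \<open>matched m e y\<close> says that \<open>y\<close> is the image of \<open>e\<close> under the orthogonal projection onto the first
  components of \<^const>\<open>paired\<close>, followed by the partial isometry \<open>x \<mapsto> y\<close>.
\<close>

definition matched :: "nat \<Rightarrow> (nat list \<Rightarrow> real) \<Rightarrow> (nat list \<Rightarrow> real) \<Rightarrow> bool" where
  "matched m e y \<longleftrightarrow>
     (\<exists>x. paired m x y \<and> (\<forall>x' y'. paired m x' y' \<longrightarrow> inner_on m e x' = inner_on m x x'))"

lemma matched_exists: "\<exists>y. matched m e y"
  using paired_projection[of "tuples m" m "paired m" e] finite_tuples paired.linear paired.zero
  unfolding matched_def by blast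

text \<open>The difference of two projections of \<open>e\<close> is a first component orthogonal to
  itself, hence 0, and \<open>paired_zero\<close> transfers this to the images.\<close>

lemma matched_unique:
  assumes "matched m e y1" "matched m e y2" "w \<in> tuples m"
  shows "y1 w = y2 w"
proof -
  obtain x1 x2 where x1: "paired m x1 y1" "\<forall>x' y'. paired m x' y' \<longrightarrow> inner_on m e x' = inner_on m x1 x'"
    and x2: "paired m x2 y2" "\<forall>x' y'. paired m x' y' \<longrightarrow> inner_on m e x' = inner_on m x2 x'"
    using assms unfolding matched_def by blast
  define x where "x w = 1 * x1 w + (- 1) * x2 w" for w
  have p: "paired m x (\<lambda>w. 1 * y1 w + (- 1) * y2 w)"
    unfolding x_def by (rule paired.linear[OF x1(1) x2(1)])
  have "inner_on m x1 x = inner_on m x2 x" using x1(2) x2(2) p by metis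
  then have "inner_on m x x = 0"
    unfolding x_def[of "w" for w, abs_def] inner_on_linear by (simp add: x_def[abs_def])
  then have "\<And>w. w \<in> tuples m \<Longrightarrow> x w = 0" using inner_on_self_eq_0 by blast
  from paired_zero[OF p this assms(3)] show ?thesis by simp
qed

lemma matched_linear:
  assumes "matched m e y" "matched m e' y'"
  shows "matched m (\<lambda>w. a * e w + b * e' w) (\<lambda>w. a * y w + b * y' w)"
proof -
  obtain x x' where "paired m x y" "\<forall>z z'. paired m z z' \<longrightarrow> inner_on m e z = inner_on m x z"
    "paired m x' y'" "\<forall>z z'. paired m z z' \<longrightarrow> inner_on m e' z = inner_on m x' z"
    using assms unfolding matched_def by blast
  then show ?thesis unfolding matched_def
    by (intro exI[of _ "\<lambda>w. a * x w + b * x' w"]) (auto simp: inner_on_linear intro: paired.linear)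
qed

lemma matched_zero: "matched m (\<lambda>_. 0) (\<lambda>_. 0)"
  unfolding matched_def using paired.zero by blast

lemma matched_sum:
  "finite A \<Longrightarrow> (\<And>k. k \<in> A \<Longrightarrow> matched m (e k) (y k)) \<Longrightarrow>
    matched m (\<lambda>w. \<Sum>k\<in>A. e k w) (\<lambda>w. \<Sum>k\<in>A. y k w)"
proof (induction A rule: finite_induct)
  case (insert k A)
  then show ?case using matched_linear[of m "e k" "y k" _ _ 1 1] by simp
qed (simp add: matched_zero)

lemma matched_cong: "matched m e y \<Longrightarrow> (\<And>w. w \<in> tuples m \<Longrightarrow> e' w = e w) \<Longrightarrow> matched m e' y"
  unfolding matched_def using inner_on_cong[of m e' e] by metis

text \<open>Against a test vector x', the inner product with \<open>ins p e\<close> is that of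
  \<open>e\<close> with \<open>del p x'\<close>, again a first component, so \<open>e\<close> may be
  replaced by its projection. The next three lemmas hold likewise, as pairs are closed under all
  four operations.\<close>

lemma matched_ins: "matched m e y \<Longrightarrow> matched (Suc m) (ins p e) (ins p y)"
  unfolding matched_def by (metis paired.ins inner_on_ins paired_del)

lemma matched_dup: "matched m e y \<Longrightarrow> matched (Suc m) (dup p e) (dup p y)"
  unfolding matched_def by (metis paired.dup inner_on_dup paired_mrg)

lemma matched_del: "matched (Suc m) e y \<Longrightarrow> matched m (del p e) (del p y)"
  unfolding matched_def by (metis paired.ins inner_on_ins paired_del inner_on_commute)

lemma matched_mrg: "matched (Suc m) e y \<Longrightarrow> matched m (mrg p e) (mrg p y)"
  unfolding matched_def by (metis paired.dup inner_on_dup paired_mrg inner_on_commute)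

section \<open>Matrix coefficients of the operators and their relations\<close>

definition coeff :: "nat list \<Rightarrow> nat list \<Rightarrow> real" where
  "coeff a b = (SOME y. matched (length b) (basis_vector b) y) a"

text \<open>Uniqueness on tuples makes the choice in \<open>coeff\<close> immaterial there.\<close>

lemma coeff_eq: "matched (length b) (basis_vector b) y \<Longrightarrow> a \<in> tuples (length b) \<Longrightarrow> coeff a b = y a"
  unfolding coeff_def by (rule matched_unique[OF someI_ex[OF matched_exists]])

lemma matched_basis_vector: "matched (length b) (basis_vector b) (\<lambda>a. coeff a b)"
  unfolding coeff_def by (rule someI_ex[OF matched_exists])

text \<open>The basis vectors on the left add up to an insertion into the basis vector of
  \<open>s @ t\<close>; its image is again an insertion, which ignores the letter \<open>i\<close>.
  Deletion, merging and duplication give the next three lemmas. Together they mirror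
  \<open>rs\<close>, \<open>cs\<close>, \<open>ip\<close>, \<open>wel_rel\<close> and
  \<open>inj_rel\<close>.\<close>

lemma coeff_row_sum:
  assumes "length a = length s" "a @ a' \<in> tuples (length s + length t)" "i \<in> {1..n}"
  shows "(\<Sum>j=1..n. coeff (a @ i # a') (s @ j # t)) = coeff (a @ a') (s @ t)"
proof -
  let ?m = "length s + length t"
  have mem: "a @ i # a' \<in> tuples (Suc ?m)" using assms by (auto simp: tuples_def)
  have 1: "matched (Suc ?m) (\<lambda>w. \<Sum>j=1..n. basis_vector (s @ j # t) w) (\<lambda>a. \<Sum>j=1..n. coeff a (s @ j # t))"
    using matched_basis_vector[of "s @ j # t" for j] by (intro matched_sum) auto
  have 2: "matched (Suc ?m) (\<lambda>w. \<Sum>j=1..n. basis_vector (s @ j # t) w) (ins (length s) (\<lambda>a. coeff a (s @ t)))"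
    using matched_cong[OF matched_ins[OF matched_basis_vector[of "s @ t"], of "length s"]] ins_basis_vector by force
  show ?thesis
    using matched_unique[OF 1 2 mem] ins_split[of a "\<lambda>a. coeff a (s @ t)" i a'] assms(1) by simp
qed

lemma coeff_col_sum:
  assumes "length a = length s" "a @ a' \<in> tuples (length s + length t)" "j \<in> {1..n}"
  shows "(\<Sum>i=1..n. coeff (a @ i # a') (s @ j # t)) = coeff (a @ a') (s @ t)"
proof -
  let ?m = "length s + length t"
  have 1: "matched ?m (del (length s) (basis_vector (s @ j # t))) (del (length s) (\<lambda>a. coeff a (s @ j # t)))"
    using matched_del[of ?m] matched_basis_vector[of "s @ j # t"] by simp
  have 2: "matched ?m (del (length s) (basis_vector (s @ j # t))) (\<lambda>a. coeff a (s @ t))"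
    using matched_cong[OF matched_basis_vector[of "s @ t"]] del_basis_vector assms(3) by force
  show ?thesis
    using matched_unique[OF 1 2 assms(2)] del_split[of a "\<lambda>a. coeff a (s @ j # t)" a'] assms(1) by simp
qed

lemma coeff_same_row:
  assumes "length a = length s" "a @ i # a' \<in> tuples (Suc (length s + length t))"
  shows "coeff (a @ i # i # a') (s @ j # k # t) = (if j = k then coeff (a @ i # a') (s @ j # t) else 0)"
proof -
  let ?m = "Suc (length s + length t)"
  have 1: "matched ?m (mrg (length s) (basis_vector (s @ j # k # t))) (mrg (length s) (\<lambda>a. coeff a (s @ j # k # t)))"
    using matched_mrg[of ?m] matched_basis_vector[of "s @ j # k # t"] by simp
  have 2: "matched ?m (mrg (length s) (basis_vector (s @ j # k # t)))
      (\<lambda>a. if j = k then coeff a (s @ j # t) else 0)"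
    using matched_cong[OF matched_basis_vector[of "s @ j # t"], of "mrg (length s) (basis_vector (s @ j # k # t))"]
      matched_cong[OF matched_zero[of ?m], of "mrg (length s) (basis_vector (s @ j # k # t))"] mrg_basis_vector
    by (cases "j = k") auto
  show ?thesis
    using matched_unique[OF 1 2 assms(2)] mrg_split[of a "\<lambda>a. coeff a (s @ j # k # t)" i a'] assms(1)
    by simp
qed

lemma coeff_same_col:
  assumes "length a = length s" "a @ i # i' # a' \<in> tuples (Suc (Suc (length s + length t)))"
  shows "coeff (a @ i # i' # a') (s @ j # j # t) = (if i = i' then coeff (a @ i # a') (s @ j # t) else 0)"
proof -
  let ?m = "Suc (Suc (length s + length t))"
  have 1: "matched ?m (basis_vector (s @ j # j # t)) (\<lambda>a. coeff a (s @ j # j # t))"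
    using matched_basis_vector[of "s @ j # j # t"] by simp
  have 2: "matched ?m (basis_vector (s @ j # j # t)) (dup (length s) (\<lambda>a. coeff a (s @ j # t)))"
    using matched_cong[OF matched_dup[OF matched_basis_vector[of "s @ j # t"], of "length s"]] dup_basis_vector by force
  show ?thesis
    using matched_unique[OF 1 2 assms(2)] dup_split[of a "\<lambda>a. coeff a (s @ j # t)" i i' a'] assms(1)
    by simp
qed

lemma coeff_below:
  assumes "length b < d" "a \<in> tuples (length b)"
  shows "coeff a b = 0"
proof -
  obtain x where "paired (length b) x (\<lambda>a. coeff a b)"
    using matched_basis_vector[of b] unfolding matched_def by blast
  from paired_below[OF this assms] show ?thesis by simp
qed

lemma coeff_at:
  assumes "length b = d" "a \<in> tuples d" "b \<in> tuples d"
  shows "coeff a b = v a * v' b / inner_on d v' v'"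
proof -
  \<comment> \<open>The projection of the basis vector of \<open>b\<close> onto the line of
    \<open>v'\<close> is \<open>c\<close> times \<open>v'\<close>; its partner is \<open>c\<close>
    times \<open>v\<close>.\<close>
  define c where "c = v' b / inner_on d v' v'"
  have "inner_on d (basis_vector b) x' = inner_on d (\<lambda>w. c * v' w) x'" if p: "paired d x' y'" for x' y'
  proof -
    obtain t where t: "\<And>w. w \<in> tuples d \<Longrightarrow> x' w = t * v' w" using paired_at[OF p] by blast
    have "inner_on d (\<lambda>w. c * v' w) x' = c * inner_on d v' x'"
      using inner_on_linear[of d c v' 0 v' x'] by simp
    also have "inner_on d v' x' = t * inner_on d v' v'"
      using inner_on_cong[of d v' v' x' "\<lambda>w. t * v' w"] t inner_on_linear_right[of d v' t v' 0 v'] by simp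
    finally show ?thesis using inner_on_basis_vector[OF assms(3)] t[OF assms(3)] v'_pos by (simp add: c_def)
  qed
  then have "matched d (basis_vector b) (\<lambda>w. c * v w)"
    unfolding matched_def using paired_scale[OF paired.base, of c] by blast
  from coeff_eq[of b, unfolded assms(1), OF this assms(2)] show ?thesis by (simp add: c_def)
qed

end

section \<open>Cuspidal vectors with prescribed last word\<close>

context tuple_space
begin

text \<open>A letter-by-letter form of being killed by all \<open>del\<close> and
  \<open>mrg\<close>, suited to building vectors slice by slice. The guard
  \<open>i # w \<in> tuples m\<close> makes the diagonal condition empty for m = 0.\<close>

fun cuspidal :: "nat \<Rightarrow> (nat list \<Rightarrow> real) \<Rightarrow> bool" where
  "cuspidal 0 v = True"
| "cuspidal (Suc m) v \<longleftrightarrow>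
     (\<forall>i\<in>{1..n}. cuspidal m (\<lambda>w. v (i # w)) \<and> (\<forall>w. i # w \<in> tuples m \<longrightarrow> v (i # i # w) = 0)) \<and>
     (\<forall>w\<in>tuples m. (\<Sum>i=1..n. v (i # w)) = 0)"

lemma cuspidal_del: "cuspidal (Suc m) v \<Longrightarrow> w \<in> tuples m \<Longrightarrow> del q v w = 0"
proof (induction q arbitrary: m v w)
  case (Suc q)
  show ?case
  proof (cases m)
    case (Suc k)
    then obtain j t where "w = j # t" "j \<in> {1..n}" "t \<in> tuples k"
      using Suc.prems(2) by (auto elim: tuples_SucE)
    then show ?thesis using Suc.IH[of k "\<lambda>w. v (j # w)" t] Suc.prems(1) Suc by simp
  qed (use Suc.prems in simp)
qed simp

lemma cuspidal_mrg: "cuspidal (Suc m) v \<Longrightarrow> w \<in> tuples m \<Longrightarrow> mrg q v w = 0"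
proof (induction q arbitrary: m v w)
  case 0
  then show ?case by (cases m) (auto elim!: tuples_SucE)
next
  case (Suc q)
  show ?case
  proof (cases m)
    case (Suc k)
    then obtain j t where "w = j # t" "j \<in> {1..n}" "t \<in> tuples k"
      using Suc.prems(2) by (auto elim: tuples_SucE)
    then show ?thesis using Suc.IH[of k "\<lambda>w. v (j # w)" t] Suc.prems(1) Suc by simp
  qed (use Suc.prems in simp)
qed

text \<open>Avoidance absorbs the diagonal condition: by \<open>cuspidal_Suc\<close>, the slice at
  letter i has to avoid i.\<close>

definition cuspidal_avoiding :: "nat \<Rightarrow> nat set \<Rightarrow> (nat list \<Rightarrow> real) \<Rightarrow> bool" where
  "cuspidal_avoiding m S v \<longleftrightarrow> cuspidal m v \<and> (\<forall>i\<in>S. \<forall>w. i # w \<in> tuples m \<longrightarrow> v (i # w) = 0)"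

lemma cuspidal_Suc:
  "cuspidal (Suc m) v \<longleftrightarrow>
     (\<forall>i\<in>{1..n}. cuspidal_avoiding m {i} (\<lambda>w. v (i # w))) \<and> (\<forall>w\<in>tuples m. (\<Sum>i=1..n. v (i # w)) = 0)"
  by (auto simp: cuspidal_avoiding_def)

lemma cuspidal_linear: "cuspidal m x \<Longrightarrow> cuspidal m y \<Longrightarrow> cuspidal m (\<lambda>w. a * x w + b * y w)"
proof (induction m arbitrary: x y)
  case (Suc m)
  then show ?case by (simp add: sum.distrib flip: sum_distrib_left)
qed simp

lemma cuspidal_avoiding_linear:
  "cuspidal_avoiding m S x \<Longrightarrow> cuspidal_avoiding m S y \<Longrightarrow>
    cuspidal_avoiding m S (\<lambda>w. a * x w + b * y w)"
  by (auto simp: cuspidal_avoiding_def cuspidal_linear)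

lemma cuspidal_zero: "cuspidal m (\<lambda>w. 0)"
  by (induction m) auto

lemma cuspidal_avoiding_zero: "cuspidal_avoiding m S (\<lambda>w. 0)"
  by (auto simp: cuspidal_avoiding_def cuspidal_zero)

lemma cuspidal_avoiding_uminus: "cuspidal_avoiding m S x \<Longrightarrow> cuspidal_avoiding m S (\<lambda>w. - x w)"
  using cuspidal_avoiding_linear[of m S x x "-1" 0] by simp

lemma cuspidal_avoiding_mono: "cuspidal_avoiding m S x \<Longrightarrow> T \<subseteq> S \<Longrightarrow> cuspidal_avoiding m T x"
  by (auto simp: cuspidal_avoiding_def)

definition glue :: "(nat \<Rightarrow> nat list \<Rightarrow> real) \<Rightarrow> nat list \<Rightarrow> real" where
  "glue z w = (case w of [] \<Rightarrow> 0 | i # t \<Rightarrow> z i t)"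

lemma glue_Cons [simp]: "glue z (i # t) = z i t"
  by (simp add: glue_def)

lemma cuspidal_avoiding_glue:
  assumes "\<And>i. i \<in> {1..n} \<Longrightarrow> cuspidal_avoiding m {i} (z i)"
    and "\<And>w. w \<in> tuples m \<Longrightarrow> (\<Sum>i=1..n. z i w) = 0"
    and "\<And>i w. i \<in> S \<Longrightarrow> w \<in> tuples m \<Longrightarrow> z i w = 0"
  shows "cuspidal_avoiding (Suc m) S (glue z)"
  using assms unfolding cuspidal_avoiding_def[of "Suc m"] cuspidal_Suc by simp

text \<open>The slices of a vector supported on three first letters. Written as a sum, its total
  over the first letter is immediate.\<close>

definition three :: "nat \<Rightarrow> nat \<Rightarrow> nat \<Rightarrow> (nat list \<Rightarrow> real) \<Rightarrow> (nat list \<Rightarrow> real) \<Rightarrow> (nat list \<Rightarrow> real)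
    \<Rightarrow> nat \<Rightarrow> nat list \<Rightarrow> real" where
  "three i p q x y z j w =
     (if j = i then x w else 0) + (if j = p then y w else 0) + (if j = q then z w else 0)"

lemma sum_three:
  assumes "i \<in> {1..n}" "p \<in> {1..n}" "q \<in> {1..n}"
  shows "(\<Sum>j=1..n. three i p q x y z j w) = x w + y w + z w"
  using assms by (simp add: three_def sum.distrib)

lemma cuspidal_avoiding_three:
  assumes "distinct [i, p, q]" "cuspidal_avoiding m {i} x" "cuspidal_avoiding m {p} y" "cuspidal_avoiding m {q} z"
  shows "cuspidal_avoiding m {j} (three i p q x y z j)"
proof -
  have "three i p q x y z j = (if j = i then x else if j = p then y else if j = q then z else (\<lambda>_. 0))"
    using assms(1) by (auto simp: three_def fun_eq_iff)
  then show ?thesis using assms cuspidal_avoiding_zero by auto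
qed

text \<open>The p-slice of \<open>v\<close> is put into a vector \<open>g\<close> without q-slice;
  its column sums are cancelled at two further letters r and s, which exist since n is at least 4.
  For this the negated slice is split by induction into parts avoiding r and s. Then
  \<open>v\<close> minus \<open>g\<close> has no p-slice.\<close>

lemma cuspidal_split:
  assumes "n \<ge> 4"
  shows "cuspidal m v \<Longrightarrow> p \<noteq> q \<Longrightarrow> p \<in> {1..n} \<Longrightarrow> q \<in> {1..n} \<Longrightarrow>
    \<exists>y z. cuspidal_avoiding m {p} y \<and> cuspidal_avoiding m {q} z \<and> (\<forall>w\<in>tuples m. v w = y w + z w)"
proof (induction m arbitrary: v p q)
  case 0
  then show ?case
    by (intro exI[of _ v] exI[of _ "\<lambda>_. 0"]) (auto simp: cuspidal_avoiding_def)
next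
  case (Suc m)
  have "card ({1..n} - {p, q}) \<ge> 2" using assms Suc.prems by (simp add: card_Diff_subset)
  then obtain r s where rs: "r \<in> {1..n} - {p, q}" "s \<in> {1..n} - {p, q}" "r \<noteq> s"
    by (metis card_le_Suc_iff insertCI numeral_2_eq_2)
  have vp: "cuspidal_avoiding m {p} (\<lambda>w. v (p # w))"
    using Suc.prems unfolding cuspidal_Suc by blast
  then have "cuspidal m (\<lambda>w. - v (p # w))"
    using cuspidal_avoiding_uminus cuspidal_avoiding_def by blast
  then obtain y z where yz: "cuspidal_avoiding m {r} y" "cuspidal_avoiding m {s} z"
    "\<And>w. w \<in> tuples m \<Longrightarrow> - v (p # w) = y w + z w"
    using Suc.IH[of "\<lambda>w. - v (p # w)" r s] rs by auto
  define g where "g = glue (three p r s (\<lambda>w. v (p # w)) y z)"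
  have g: "cuspidal_avoiding (Suc m) {q} g"
    unfolding g_def
  proof (rule cuspidal_avoiding_glue)
    show "cuspidal_avoiding m {i} (three p r s (\<lambda>w. v (p # w)) y z i)" for i
      using rs by (intro cuspidal_avoiding_three vp yz) auto
    show "(\<Sum>i=1..n. three p r s (\<lambda>w. v (p # w)) y z i w) = 0" if "w \<in> tuples m" for w
      using sum_three[of p r s] rs Suc.prems yz(3)[OF that] by auto
  qed (use rs Suc.prems in \<open>auto simp: three_def\<close>)
  have "g (p # w) = v (p # w)" for w using rs by (auto simp: g_def three_def)
  then have "cuspidal_avoiding (Suc m) {p} (\<lambda>w. 1 * v w + (- 1) * g w)"
    using cuspidal_linear[OF Suc.prems(1), of g 1 "- 1"] g by (simp add: cuspidal_avoiding_def)
  with g show ?case by (intro exI[of _ "\<lambda>w. 1 * v w + (- 1) * g w"] exI[of _ g]) simp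
qed

section \<open>Vectors with a prescribed last word\<close>

text \<open>The row words and the column words of the normal words.\<close>

definition admissible :: "nat list \<Rightarrow> bool" where
  "admissible a \<longleftrightarrow> set a \<subseteq> {2..n} \<and> distinct_adj a \<and> \<not> sublist [2, 3] a \<and> \<not> sublist [2, 4, 3] a"

text \<open>The first word precedes the second in dictionary order; it is the greater one in the
  sense of the symbol order, where small indices are large.\<close>

definition index_greater :: "(nat list \<times> nat list) set" where
  "index_greater = lex {(i, j). i < j}"

lemma admissible_Cons: "admissible (i # a) \<Longrightarrow> admissible a"
  by (auto simp: admissible_def distinct_adj_Cons sublist_Cons_right)

lemma admissible_tuples: "admissible a \<Longrightarrow> a \<in> tuples (length a)"
  by (auto simp: admissible_def tuples_def)

text \<open>\<open>a\<close> is the last word of the support, with coefficient 1. The set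
  \<open>S\<close> of forbidden first letters strengthens the induction, since a slice must not
  start with the letter it is attached to.\<close>

definition peak :: "nat set \<Rightarrow> nat list \<Rightarrow> (nat list \<Rightarrow> real) \<Rightarrow> bool" where
  "peak S a v \<longleftrightarrow> cuspidal_avoiding (length a) S v \<and> v a = 1 \<and>
     (\<forall>b\<in>tuples (length a). (a, b) \<in> index_greater \<longrightarrow> v b = 0)"

text \<open>The slice at \<open>i\<close> carries the peak. The slices at \<open>p\<close> and
  \<open>q\<close> only restore the vanishing column sums; lying at smaller letters, or being 0,
  they add no later word.\<close>

lemma peak_Cons:
  assumes "peak {i} s x" "distinct [i, p, q]" "i \<in> {1..n}" "p \<in> {1..n}" "q \<in> {1..n}"
    and "cuspidal_avoiding (length s) {p} y" "cuspidal_avoiding (length s) {q} z"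
    and "\<And>w. w \<in> tuples (length s) \<Longrightarrow> x w + y w + z w = 0"
    and "p < i" "q < i \<or> z = (\<lambda>_. 0)"
    and "i \<notin> S" "p \<notin> S" "q \<notin> S \<or> z = (\<lambda>_. 0)"
  shows "peak S (i # s) (glue (three i p q x y z))"
proof -
  have "cuspidal_avoiding (Suc (length s)) S (glue (three i p q x y z))"
  proof (rule cuspidal_avoiding_glue)
    show "cuspidal_avoiding (length s) {j} (three i p q x y z j)" for j
      using assms by (intro cuspidal_avoiding_three) (auto simp: peak_def)
    show "(\<Sum>i'=1..n. three i p q x y z i' w) = 0" if "w \<in> tuples (length s)" for w
      using sum_three[of i p q] assms that by auto
  qed (use assms in \<open>auto simp: three_def\<close>)
  moreover have "glue (three i p q x y z) (i # s) = 1"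
    using assms by (auto simp: three_def peak_def)
  moreover have "glue (three i p q x y z) b = 0"
    if b: "b \<in> tuples (Suc (length s))" "(i # s, b) \<in> index_greater" for b
  proof -
    obtain k t where k: "b = k # t" "t \<in> tuples (length s)" using b by (auto elim: tuples_SucE)
    then have "i < k \<or> i = k \<and> (s, t) \<in> index_greater" using b(2) by (auto simp: index_greater_def)
    then show ?thesis using k assms by (auto simp: three_def peak_def)
  qed
  ultimately show ?thesis by (simp add: peak_def)
qed

text \<open>
  Induction on the first letter \<open>i\<close>, whose component has to be cancelled by components of smaller
  first letters: by two of them, \<open>{1, 2}\<close> or \<open>{3, 4}\<close>, via \<open>cuspidal_split\<close> if they are
  available, and otherwise by a single one, which then has to be avoided as well. Avoiding \<open>{1, 2}\<close> arises
  below the letter \<open>2\<close>, and avoiding \<open>{3, 4}\<close> below \<open>24\<close>; this is where \<open>23\<close> and \<open>243\<close> drop out.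
\<close>

lemma peak_exists:
  assumes n: "n \<ge> 4"
  shows "admissible a \<Longrightarrow> S = {} \<or> (\<exists>j\<ge>3. S = {j} \<and> admissible (j # a)) \<or>
    S = {1, 2} \<and> admissible (2 # a) \<or> S = {3, 4} \<and> admissible (2 # 4 # a) \<Longrightarrow> \<exists>v. peak S a v"
proof (induction a arbitrary: S)
  case Nil
  then show ?case by (intro exI[of _ "\<lambda>_. 1"]) (auto simp: peak_def cuspidal_avoiding_def index_greater_def)
next
  case (Cons i s)
  have s: "admissible s" using Cons.prems(1) by (rule admissible_Cons)
  have i: "2 \<le> i" "i \<le> n" using Cons.prems(1) by (auto simp: admissible_def)
  have large: "\<exists>v. peak S (i # s) v"
    if pq: "3 \<le> i" "p < q" "q < i" "0 < p" "i \<notin> S" "p \<notin> S" "q \<notin> S" for p q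
  proof -
    obtain x where x: "peak {i} s x" using Cons.IH[OF s, of "{i}"] Cons.prems(1) pq by auto
    then have "cuspidal (length s) (\<lambda>w. - x w)"
      using cuspidal_avoiding_uminus unfolding peak_def cuspidal_avoiding_def by blast
    then obtain y z where yz: "cuspidal_avoiding (length s) {p} y" "cuspidal_avoiding (length s) {q} z"
      "\<And>w. w \<in> tuples (length s) \<Longrightarrow> - x w = y w + z w"
      using cuspidal_split[OF n, of "length s" "\<lambda>w. - x w" p q] pq i by auto
    moreover have "x w + y w + z w = 0" if "w \<in> tuples (length s)" for w
      using yz(3)[OF that] by linarith
    ultimately have "peak S (i # s) (glue (three i p q x y z))"
      using pq i by (intro peak_Cons x) auto
    then show ?thesis by blast
  qed
  have two: "\<exists>v. peak S (i # s) v"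
    if "peak {i, p} s x" "0 < p" "p < i" "i \<notin> S" "p \<notin> S" for p x
  proof -
    \<comment> \<open>\<open>peak_Cons\<close> expects three distinct letters; \<open>q\<close> will
      carry the zero slice.\<close>
    have "\<exists>q\<in>{1..n}. q \<noteq> i \<and> q \<noteq> p"
    proof -
      have "card ({1..n} - {i, p}) > 0" using n that i by (simp add: card_Diff_subset)
      then show ?thesis by (metis DiffD1 DiffD2 card_gt_0_iff equals0I insertCI)
    qed
    then obtain q where q: "q \<in> {1..n}" "q \<noteq> i" "q \<noteq> p" by blast
    have x: "cuspidal_avoiding (length s) {i, p} x" using that(1) by (simp add: peak_def)
    have "peak {i} s x" using that(1) cuspidal_avoiding_mono[OF x, of "{i}"] by (auto simp: peak_def)
    moreover have "cuspidal_avoiding (length s) {p} (\<lambda>w. - x w)"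
      using cuspidal_avoiding_mono[OF x, of "{p}"] by (auto intro: cuspidal_avoiding_uminus)
    ultimately have "peak S (i # s) (glue (three i p q x (\<lambda>w. - x w) (\<lambda>_. 0)))"
      using q that i by (intro peak_Cons cuspidal_avoiding_zero) auto
    then show ?thesis by blast
  qed
  show ?case
  proof (cases "S = {1, 2}")
    case True
    then have adm: "admissible (2 # i # s)" using Cons.prems(2) by (auto simp: admissible_def)
    then have "i \<noteq> 2" "i \<noteq> 3" by (auto simp: admissible_def distinct_adj_Cons)
    show ?thesis
    proof (cases "i = 4")
      case i4: True
      \<comment> \<open>With 1 and 2 forbidden, 3 is the only letter below 4 that can cancel, so the
        slice must avoid 3 as well as 4.\<close>
      obtain x where "peak {3, 4} s x" using Cons.IH[OF s, of "{3, 4}"] adm i4 by auto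
      then show ?thesis using two[of 3 x] True i4 by (simp add: insert_commute)
    next
      case False
      then show ?thesis using large[of 3 4] \<open>i \<noteq> 2\<close> \<open>i \<noteq> 3\<close> i True by auto
    qed
  next
    case False
    have S: "1 \<notin> S" "2 \<notin> S" "i \<notin> S"
      using Cons.prems(2) False by (auto simp: admissible_def distinct_adj_Cons)
    show ?thesis
    proof (cases "i = 2")
      case True
      obtain x where "peak {1, 2} s x" using Cons.IH[OF s, of "{1, 2}"] Cons.prems(1) True by auto
      then show ?thesis using two[of 1 x] S True by (simp add: insert_commute)
    next
      case False
      then show ?thesis using large[of 1 2] i S by auto
    qed
  qed
qed

lemma cuspidal_peak:
  assumes "n \<ge> 4" "admissible a"
  obtains v where "cuspidal (length a) v" "v a = 1"
    "\<And>b. b \<in> tuples (length a) \<Longrightarrow> (a, b) \<in> index_greater \<Longrightarrow> v b = 0"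
  using peak_exists[OF assms, of "{}"] unfolding peak_def cuspidal_avoiding_def by blast

end

section \<open>Functionals vanishing on the ideal\<close>

definition lin :: "('a \<Rightarrow> complex) \<Rightarrow> ('a \<Rightarrow>\<^sub>0 complex) \<Rightarrow> complex" where
  "lin \<psi> f = (\<Sum>w\<in>Poly_Mapping.keys f. Poly_Mapping.lookup f w * \<psi> w)"

lemma lin_superset:
  "finite A \<Longrightarrow> Poly_Mapping.keys f \<subseteq> A \<Longrightarrow> lin \<psi> f = (\<Sum>w\<in>A. Poly_Mapping.lookup f w * \<psi> w)"
  unfolding lin_def by (rule sum.mono_neutral_left) (auto simp: in_keys_iff)

lemma lin_0 [simp]: "lin \<psi> 0 = 0"
  by (simp add: lin_def)

lemma lin_add: "lin \<psi> (f + g) = lin \<psi> f + lin \<psi> g"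
proof -
  let ?A = "Poly_Mapping.keys f \<union> Poly_Mapping.keys g"
  have "lin \<psi> (f + g) = (\<Sum>w\<in>?A. Poly_Mapping.lookup (f + g) w * \<psi> w)"
    using Poly_Mapping.keys_add[of f g] by (intro lin_superset) auto
  then show ?thesis
    by (simp add: lookup_add distrib_right sum.distrib lin_superset[of ?A])
qed

lemma lin_uminus: "lin \<psi> (- f) = - lin \<psi> f"
  using lin_add[of \<psi> f "- f"] by (simp add: eq_neg_iff_add_eq_0 add.commute)

lemma lin_diff: "lin \<psi> (f - g) = lin \<psi> f - lin \<psi> g"
  using lin_add[of \<psi> f "- g"] by (simp add: lin_uminus)

lemma lin_sum: "lin \<psi> (sum f A) = (\<Sum>k\<in>A. lin \<psi> (f k))"
  by (induction A rule: infinite_finite_induct) (auto simp: lin_add)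

lemma lin_single [simp]: "lin \<psi> (Poly_Mapping.single w c) = c * \<psi> w"
  using lin_superset[of "{w}" "Poly_Mapping.single w c" \<psi>] by simp

lemma sum_single_lookup:
  "f = (\<Sum>w\<in>Poly_Mapping.keys f. Poly_Mapping.single w (Poly_Mapping.lookup f w))" (is "_ = ?g")
proof (rule poly_mapping_eqI)
  fix v
  have "Poly_Mapping.lookup ?g v = (\<Sum>w\<in>Poly_Mapping.keys f. if w = v then Poly_Mapping.lookup f v else 0)"
    by (auto simp: lookup_sum lookup_single when_def intro!: sum.cong)
  then show "Poly_Mapping.lookup f v = Poly_Mapping.lookup ?g v"
    by (simp add: in_keys_iff)
qed

text \<open>Multiplying from the left amounts to combining left translates of the functional;
  \<open>lin_mult_right\<close> is the mirror image. This is what makes \<open>J\<close> below an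
  ideal.\<close>

lemma lin_mult:
  "lin \<psi> (f * g) = (\<Sum>s\<in>Poly_Mapping.keys f. Poly_Mapping.lookup f s * lin (\<lambda>t. \<psi> (s + t)) g)"
proof -
  have "f * g = (\<Sum>s\<in>Poly_Mapping.keys f. \<Sum>t\<in>Poly_Mapping.keys g.
      Poly_Mapping.single (s + t) (Poly_Mapping.lookup f s * Poly_Mapping.lookup g t))"
    by (subst sum_single_lookup[of f], subst sum_single_lookup[of g])
       (simp add: sum_product mult_single)
  then show ?thesis
    by (simp add: lin_sum lin_def[of _ g] sum_distrib_left mult.assoc)
qed

lemma lin_mult_right:
  "lin \<psi> (f * g) = (\<Sum>t\<in>Poly_Mapping.keys g. Poly_Mapping.lookup g t * lin (\<lambda>s. \<psi> (s + t)) f)"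
  unfolding lin_mult lin_def[of _ f] lin_def[of _ g] sum_distrib_left
  by (subst sum.swap) (simp add: mult_ac)

lemma lin_one [simp]: "lin \<psi> (1 :: 'b::monoid_add \<Rightarrow>\<^sub>0 complex) = \<psi> 0"
  unfolding single_one[symmetric] by (simp del: single_one)

lemma u_mult_u: "u i j * u k l = Poly_Mapping.single [(i, j), (k, l)] 1"
  by (simp add: u_def mult_single plus_list_def)

abbreviation letters :: "nat \<Rightarrow> (nat \<times> nat) set" where
  "letters n \<equiv> {1..n} \<times> {1..n}"

text \<open>The elements killed by all two-sided translates of \<open>\<phi>\<close> form a
  two-sided ideal inside the kernel of the functional, so it suffices to test relations placed
  between two words.\<close>

lemma ideal_annihilated:
  fixes \<phi> :: "word \<Rightarrow> complex"
  assumes rel: "\<And>r p q. r \<in> symmetry_relations n \<Longrightarrow> p \<in> lists (letters n) \<Longrightarrow> q \<in> lists (letters n) \<Longrightarrow>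
      lin (\<lambda>w. \<phi> (p @ w @ q)) r = 0"
    and "symmetry_relations n \<subseteq> carrier (free_algebra n)"
    and "f \<in> qsym_ideal n"
  shows "lin \<phi> f = 0"
proof -
  interpret R: ring "free_algebra n" by (rule ring_free_algebra)
  define J where "J = {f \<in> carrier (free_algebra n).
    \<forall>p\<in>lists (letters n). \<forall>q\<in>lists (letters n). lin (\<lambda>w. \<phi> (p @ w @ q)) f = 0}"
  have inv: "\<ominus>\<^bsub>free_algebra n\<^esub> f = - f" if "f \<in> carrier (free_algebra n)" for f
    using that by (intro R.minus_equality) (auto simp: free_algebra_def)
  have keys: "s \<in> lists (letters n)" if "f \<in> carrier (free_algebra n)" "s \<in> Poly_Mapping.keys f" for f s
    using that by (auto simp: free_algebra_def)
  have "ideal J (free_algebra n)"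
  proof (rule idealI[OF ring_free_algebra])
    show "subgroup J (add_monoid (free_algebra n))"
    proof
      show "x \<otimes>\<^bsub>add_monoid (free_algebra n)\<^esub> y \<in> J" if "x \<in> J" "y \<in> J" for x y
        using that R.add.m_closed[of x y] by (auto simp: J_def free_algebra_def lin_add)
      show "inv\<^bsub>add_monoid (free_algebra n)\<^esub> x \<in> J" if "x \<in> J" for x
        using that inv[of x] R.add.inv_closed[of x]
        by (auto simp: J_def a_inv_def lin_uminus)
      show "\<one>\<^bsub>add_monoid (free_algebra n)\<^esub> \<in> J"
        using R.zero_closed by (auto simp: J_def free_algebra_def)
    qed (auto simp: J_def)
    show "x \<otimes>\<^bsub>free_algebra n\<^esub> a \<in> J" if "a \<in> J" "x \<in> carrier (free_algebra n)" for a x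
    proof -
      have "lin (\<lambda>w. \<phi> (p @ w @ q)) (x * a) = 0" if "p \<in> lists (letters n)" "q \<in> lists (letters n)" for p q
        unfolding lin_mult
      proof (rule sum.neutral, rule ballI)
        fix s assume "s \<in> Poly_Mapping.keys x"
        then have "p @ s \<in> lists (letters n)" using keys that \<open>x \<in> carrier _\<close> by auto
        then have "lin (\<lambda>t. \<phi> ((p @ s) @ t @ q)) a = 0" using \<open>a \<in> J\<close> that unfolding J_def by blast
        then show "Poly_Mapping.lookup x s * lin (\<lambda>t. \<phi> (p @ (s + t) @ q)) a = 0"
          by (simp add: plus_list_def)
      qed
      moreover have "x \<otimes>\<^bsub>free_algebra n\<^esub> a \<in> carrier (free_algebra n)"
        using that by (intro R.m_closed) (auto simp: J_def)
      ultimately show ?thesis by (auto simp: J_def free_algebra_def)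
    qed
    show "a \<otimes>\<^bsub>free_algebra n\<^esub> x \<in> J" if "a \<in> J" "x \<in> carrier (free_algebra n)" for a x
    proof -
      have "lin (\<lambda>w. \<phi> (p @ w @ q)) (a * x) = 0" if "p \<in> lists (letters n)" "q \<in> lists (letters n)" for p q
        unfolding lin_mult_right
      proof (rule sum.neutral, rule ballI)
        fix s assume "s \<in> Poly_Mapping.keys x"
        then have "s @ q \<in> lists (letters n)" using keys that \<open>x \<in> carrier _\<close> by auto
        then have "lin (\<lambda>t. \<phi> (p @ t @ (s @ q))) a = 0" using \<open>a \<in> J\<close> that unfolding J_def by blast
        then show "Poly_Mapping.lookup x s * lin (\<lambda>t. \<phi> (p @ (t + s) @ q)) a = 0"
          by (simp add: plus_list_def)
      qed
      moreover have "a \<otimes>\<^bsub>free_algebra n\<^esub> x \<in> carrier (free_algebra n)"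
        using that by (intro R.m_closed) (auto simp: J_def)
      ultimately show ?thesis by (auto simp: J_def free_algebra_def)
    qed
  qed
  moreover have "symmetry_relations n \<subseteq> J"
    using rel assms(2) by (auto simp: J_def)
  ultimately have "qsym_ideal n \<subseteq> J"
    unfolding qsym_ideal_def by (rule R.genideal_minimal)
  then have "f \<in> J" using assms(3) by blast
  then have "lin (\<lambda>w. \<phi> ([] @ w @ [])) f = 0" unfolding J_def by blast
  then show ?thesis by simp
qed

text \<open>The surrounding words split the row word and the column word at the same place, so each
  family of relations becomes one of the \<open>coeff\<close> identities.\<close>

lemma (in cuspidal_pair) lin_coeff_symmetry_relations:
  assumes "r \<in> symmetry_relations n" "p \<in> lists (letters n)" "q \<in> lists (letters n)"
  shows "lin (\<lambda>w. complex_of_real (coeff (map fst (p @ w @ q)) (map snd (p @ w @ q)))) r = 0"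
proof -
  define a s where "a = map fst p" and "s = map snd p"
  define a' t where "a' = map fst q" and "t = map snd q"
  have len: "length a = length s" "length a' = length t" by (simp_all add: a_def s_def a'_def t_def)
  have range: "set a \<subseteq> {1..n}" "set a' \<subseteq> {1..n}" using assms(2,3) by (auto simp: a_def a'_def)
  have mem: "a @ b @ a' \<in> tuples (length s + (length b + length t))" if "set b \<subseteq> {1..n}" for b
    using that range len by (auto simp: tuples_def)
  have lin2: "lin (\<lambda>w. \<psi> (w @ q)) (u i j ^ 2 - u i j) = \<psi> ([(i, j), (i, j)] @ q) - \<psi> ([(i, j)] @ q)" for \<psi> i j
    by (simp add: power2_eq_square lin_diff u_mult_u) (simp add: u_def)
  consider (rs) i where "r = rs n i" "i \<in> {1..n}" | (cs) j where "r = cs n j" "j \<in> {1..n}"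
    | (ip) i j where "r = ip i j" "i \<in> {1..n}" "j \<in> {1..n}"
    | (inj) i j k where "r = inj_rel j i k" "i \<in> {1..n}" "j \<in> {1..n}" "k \<in> {1..n}" "j \<noteq> k"
    | (wel) i j k where "r = wel_rel i j k" "i \<in> {1..n}" "j \<in> {1..n}" "k \<in> {1..n}" "j \<noteq> k"
    using assms(1) unfolding symmetry_relations_def by blast
  then show ?thesis
  proof cases
    case rs
    have "(\<Sum>j=1..n. coeff (a @ i # a') (s @ j # t)) = coeff (a @ a') (s @ t)"
      using coeff_row_sum[of a s a' t i] len mem[of "[]"] rs by simp
    then show ?thesis
      by (simp add: rs rs_def lin_diff lin_sum u_def zero_list_def flip: a_def s_def a'_def t_def of_real_sum)
  next
    case cs
    have "(\<Sum>i=1..n. coeff (a @ i # a') (s @ j # t)) = coeff (a @ a') (s @ t)"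
      using coeff_col_sum[of a s a' t j] len mem[of "[]"] cs by simp
    then show ?thesis
      by (simp add: cs cs_def lin_diff lin_sum u_def zero_list_def flip: a_def s_def a'_def t_def of_real_sum)
  next
    case ip
    have "coeff (a @ i # i # a') (s @ j # j # t) = coeff (a @ i # a') (s @ j # t)"
      using coeff_same_row[of a s i a' t j j] len mem[of "[i]"] ip by simp
    then show ?thesis
      by (simp add: ip ip_def power2_eq_square lin_diff u_mult_u flip: a_def s_def a'_def t_def)
         (simp add: u_def flip: a_def s_def a'_def t_def)
  next
    case inj
    have "coeff (a @ j # k # a') (s @ i # i # t) = 0"
      using coeff_same_col[of a s j k a' t i] len mem[of "[j, k]"] inj by simp
    then show ?thesis
      by (simp add: inj inj_rel_def u_mult_u flip: a_def s_def a'_def t_def)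
  next
    case wel
    have "coeff (a @ i # i # a') (s @ j # k # t) = 0"
      using coeff_same_row[of a s i a' t j k] len mem[of "[i]"] wel by simp
    then show ?thesis
      by (simp add: wel wel_rel_def u_mult_u flip: a_def s_def a'_def t_def)
  qed
qed

lemma carrier_free_algebra: "f \<in> carrier (free_algebra n) \<longleftrightarrow> Poly_Mapping.keys f \<subseteq> lists (letters n)"
  by (simp add: free_algebra_def)

lemma carrier_free_algebra_intros:
  "f \<in> carrier (free_algebra n) \<Longrightarrow> g \<in> carrier (free_algebra n) \<Longrightarrow> f + g \<in> carrier (free_algebra n)"
  "f \<in> carrier (free_algebra n) \<Longrightarrow> g \<in> carrier (free_algebra n) \<Longrightarrow> f - g \<in> carrier (free_algebra n)"
  "f \<in> carrier (free_algebra n) \<Longrightarrow> g \<in> carrier (free_algebra n) \<Longrightarrow> f * g \<in> carrier (free_algebra n)"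
  "1 \<in> carrier (free_algebra n)"
  "(\<And>k. k \<in> A \<Longrightarrow> h k \<in> carrier (free_algebra n)) \<Longrightarrow> sum h A \<in> carrier (free_algebra n)"
  "i \<in> {1..n} \<Longrightarrow> j \<in> {1..n} \<Longrightarrow> u i j \<in> carrier (free_algebra n)"
proof -
  interpret R: ring "free_algebra n" by (rule ring_free_algebra)
  show "f \<in> carrier (free_algebra n) \<Longrightarrow> g \<in> carrier (free_algebra n) \<Longrightarrow> f + g \<in> carrier (free_algebra n)"
    using R.a_closed[of f g] by (simp add: free_algebra_def)
  show "f \<in> carrier (free_algebra n) \<Longrightarrow> g \<in> carrier (free_algebra n) \<Longrightarrow> f * g \<in> carrier (free_algebra n)"
    using R.m_closed[of f g] by (simp add: free_algebra_def)
  show "1 \<in> carrier (free_algebra n)" using R.one_closed by (simp add: free_algebra_def)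
  show "f \<in> carrier (free_algebra n) \<Longrightarrow> g \<in> carrier (free_algebra n) \<Longrightarrow> f - g \<in> carrier (free_algebra n)"
    using keys_diff[of f g] unfolding carrier_free_algebra by blast
  show "(\<And>k. k \<in> A \<Longrightarrow> h k \<in> carrier (free_algebra n)) \<Longrightarrow> sum h A \<in> carrier (free_algebra n)"
    using keys_sum[of h A] unfolding carrier_free_algebra by blast
  show "i \<in> {1..n} \<Longrightarrow> j \<in> {1..n} \<Longrightarrow> u i j \<in> carrier (free_algebra n)"
    by (simp add: carrier_free_algebra u_def)
qed

lemma symmetry_relations_carrier: "symmetry_relations n \<subseteq> carrier (free_algebra n)"
  unfolding symmetry_relations_def rs_def cs_def ip_def inj_rel_def wel_rel_def power2_eq_square
  by (auto intro!: carrier_free_algebra_intros)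

lemma (in cuspidal_pair) lin_coeff_qsym_ideal:
  "f \<in> qsym_ideal n \<Longrightarrow> lin (\<lambda>w. complex_of_real (coeff (map fst w) (map snd w))) f = 0"
  by (rule ideal_annihilated[OF lin_coeff_symmetry_relations symmetry_relations_carrier])

lemma qsym_ideal_ideal: "ideal (qsym_ideal n) (free_algebra n)"
  unfolding qsym_ideal_def
  by (intro ring.genideal_ideal ring_free_algebra symmetry_relations_carrier)

lemma qsym_ideal_carrier: "qsym_ideal n \<subseteq> carrier (free_algebra n)"
  using ideal.Icarr[OF qsym_ideal_ideal] by blast

text \<open>The functional of the pair vanishes on \<open>f\<close>; shorter words contribute
  nothing by \<open>coeff_below\<close>, and words of length \<open>d\<close> are evaluated by
  \<open>coeff_at\<close>. The word \<open>b\<close> witnesses that the norm of \<open>v'\<close> is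
  positive.\<close>

lemma qsym_ideal_top_degree:
  assumes "f \<in> qsym_ideal n" "\<And>w. w \<in> Poly_Mapping.keys f \<Longrightarrow> length w \<le> d"
    and "tuple_space.cuspidal n d v" "tuple_space.cuspidal n d v'"
    and b: "b \<in> tuple_space.tuples n d" "v' b \<noteq> 0"
  shows "(\<Sum>w | w \<in> Poly_Mapping.keys f \<and> length w = d.
     Poly_Mapping.lookup f w * complex_of_real (v (map fst w) * v' (map snd w))) = 0"
proof -
  interpret T: tuple_space n .
  have pos: "T.inner_on d v' v' > 0"
    using T.inner_on_self_nonneg[of d v'] T.inner_on_self_eq_0[of d v' b] b by fastforce
  interpret cuspidal_pair n d v v'
    using assms pos by unfold_locales (auto simp: T.cuspidal_del T.cuspidal_mrg)
  let ?N = "T.inner_on d v' v'"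
  let ?\<phi> = "\<lambda>w. complex_of_real (coeff (map fst w) (map snd w))"
  have N: "?N \<noteq> 0" using v'_pos by simp
  have key: "map fst w \<in> T.tuples (length w)" "map snd w \<in> T.tuples (length w)"
    if "w \<in> Poly_Mapping.keys f" for w
  proof -
    have "w \<in> lists (letters n)"
      using that assms(1) qsym_ideal_carrier carrier_free_algebra by blast
    then show "map fst w \<in> T.tuples (length w)" "map snd w \<in> T.tuples (length w)"
      by (auto simp: T.tuples_def)
  qed
  have "0 = lin ?\<phi> f" using lin_coeff_qsym_ideal[OF assms(1)] by simp
  also have "\<dots> = (\<Sum>w | w \<in> Poly_Mapping.keys f \<and> length w = d. Poly_Mapping.lookup f w * ?\<phi> w)"
    unfolding lin_def using assms(2) key coeff_below
    by (intro sum.mono_neutral_right) (force simp: le_less)+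
  also have "\<dots> = (\<Sum>w | w \<in> Poly_Mapping.keys f \<and> length w = d.
      Poly_Mapping.lookup f w * complex_of_real (v (map fst w) * v' (map snd w)) / ?N)"
  proof (rule sum.cong[OF refl])
    fix w assume w: "w \<in> {w \<in> Poly_Mapping.keys f. length w = d}"
    then have "coeff (map fst w) (map snd w) = v (map fst w) * v' (map snd w) / ?N"
      using key[of w] by (intro coeff_at) auto
    then show "Poly_Mapping.lookup f w * ?\<phi> w =
      Poly_Mapping.lookup f w * complex_of_real (v (map fst w) * v' (map snd w)) / ?N" by simp
  qed
  finally show ?thesis using N by (simp flip: sum_divide_distrib)
qed

section \<open>Leading monomials\<close>

lemma sym_less_iff [simp]: "((i, j), (k, l)) \<in> sym_less \<longleftrightarrow> k < i \<or> k = i \<and> l < j"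
  by (simp add: sym_less_def)

lemma word_less_iff: "(v, w) \<in> word_less \<longleftrightarrow>
    length v < length w \<or> length v = length w \<and> (v, w) \<in> lex sym_less"
  by (simp add: word_less_def lenlex_conv)

lemma trans_sym_less: "trans sym_less"
  by (rule transI) auto

lemma word_less_trans: "(v1, v) \<in> word_less \<Longrightarrow> (v, w) \<in> word_less \<Longrightarrow> (v1, w) \<in> word_less"
  unfolding word_less_def using lenlex_transI[OF trans_sym_less] by (meson transD)

lemma word_less_irrefl: "(w, w) \<notin> word_less"
  unfolding word_less_def by (rule lenlex_irreflexive) auto

lemma word_less_total:
  assumes "v \<noteq> w" shows "(v, w) \<in> word_less \<or> (w, v) \<in> word_less"
proof -
  have "total sym_less" by (auto simp: total_on_def)
  from total_lenlex[OF this] assms show ?thesis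
    by (simp add: word_less_def total_on_def)
qed

lemma lm_eqI:
  assumes "w \<in> Poly_Mapping.keys f" "\<And>v. v \<in> Poly_Mapping.keys f \<Longrightarrow> v \<noteq> w \<Longrightarrow> (v, w) \<in> word_less"
  shows "lm f = w"
  unfolding lm_def
proof (rule the_equality)
  fix w' assume w': "w' \<in> Poly_Mapping.keys f \<and> (\<forall>v\<in>Poly_Mapping.keys f. v \<noteq> w' \<longrightarrow> (v, w') \<in> word_less)"
  show "w' = w"
  proof (rule ccontr)
    assume "w' \<noteq> w"
    then have "(w', w) \<in> word_less" "(w, w') \<in> word_less" using assms w' by auto
    then show False using word_less_trans word_less_irrefl by blast
  qed
qed (use assms in auto)

lemma ex_greatest_word:
  "finite A \<Longrightarrow> A \<noteq> {} \<Longrightarrow> \<exists>w\<in>A. \<forall>v\<in>A. v \<noteq> w \<longrightarrow> (v, w) \<in> word_less"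
proof (induction A rule: finite_ne_induct)
  case (insert x A)
  then obtain w where w: "w \<in> A" "\<forall>v\<in>A. v \<noteq> w \<longrightarrow> (v, w) \<in> word_less" by blast
  have "x \<noteq> w" using w(1) insert.hyps by blast
  from word_less_total[OF this] show ?case
  proof
    assume "(x, w) \<in> word_less"
    with w show ?thesis by (intro bexI[of _ w]) auto
  next
    assume x: "(w, x) \<in> word_less"
    have "(v, x) \<in> word_less" if "v \<in> A" for v
      using w(2) that x word_less_trans[of v w x] by (cases "v = w") auto
    then show ?thesis by (intro bexI[of _ x]) auto
  qed
qed simp

lemma lm_in_keys: "f \<noteq> 0 \<Longrightarrow> lm f \<in> Poly_Mapping.keys f"
  and lm_greatest: "f \<noteq> 0 \<Longrightarrow> v \<in> Poly_Mapping.keys f \<Longrightarrow> v \<noteq> lm f \<Longrightarrow> (v, lm f) \<in> word_less"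
proof -
  have "lm f \<in> Poly_Mapping.keys f \<and> (\<forall>v\<in>Poly_Mapping.keys f. v \<noteq> lm f \<longrightarrow> (v, lm f) \<in> word_less)"
    if "f \<noteq> 0"
  proof -
    have "\<exists>w\<in>Poly_Mapping.keys f. \<forall>v\<in>Poly_Mapping.keys f. v \<noteq> w \<longrightarrow> (v, w) \<in> word_less"
      using that by (intro ex_greatest_word) auto
    then show ?thesis using lm_eqI by metis
  qed
  then show "f \<noteq> 0 \<Longrightarrow> lm f \<in> Poly_Mapping.keys f"
    "f \<noteq> 0 \<Longrightarrow> v \<in> Poly_Mapping.keys f \<Longrightarrow> v \<noteq> lm f \<Longrightarrow> (v, lm f) \<in> word_less" by blast+
qed

text \<open>At the first differing symbol of the smaller word, the row index is larger, or the rows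
  agree and the column index is larger. Up to there both index words agree, so one of them comes
  later in dictionary order.\<close>

lemma lex_sym_less_index_greater:
  "(v, w) \<in> lex sym_less \<Longrightarrow>
    (map fst w, map fst v) \<in> tuple_space.index_greater \<or> (map snd w, map snd v) \<in> tuple_space.index_greater"
proof (induction w arbitrary: v)
  case (Cons x w)
  then obtain y v' where v: "v = y # v'" by (cases v) auto
  have len: "length v = length (x # w)" using Cons.prems by (auto simp: lex_conv)
  obtain i j k l where "x = (i, j)" "y = (k, l)" by fastforce
  then show ?case
    using Cons v len by (auto simp: tuple_space.index_greater_def)
qed auto

text \<open>If both index words were admissible, peaks at them would kill every other word of top
  length, and the vanishing pairing would reduce to the leading coefficient.\<close>

lemma lm_qsym_ideal:
  assumes n: "n \<ge> 4" and f: "f \<in> qsym_ideal n" "f \<noteq> 0"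
  shows "\<not> tuple_space.admissible n (map fst (lm f)) \<or> \<not> tuple_space.admissible n (map snd (lm f))"
proof (rule ccontr)
  interpret T: tuple_space n .
  assume "\<not> ?thesis"
  then have adm: "T.admissible (map fst (lm f))" "T.admissible (map snd (lm f))" by auto
  let ?d = "length (lm f)"
  obtain v where v: "T.cuspidal ?d v" "v (map fst (lm f)) = 1"
    "\<And>b. b \<in> T.tuples ?d \<Longrightarrow> (map fst (lm f), b) \<in> T.index_greater \<Longrightarrow> v b = 0"
    using T.cuspidal_peak[OF n adm(1)] by auto
  obtain v' where v': "T.cuspidal ?d v'" "v' (map snd (lm f)) = 1"
    "\<And>b. b \<in> T.tuples ?d \<Longrightarrow> (map snd (lm f), b) \<in> T.index_greater \<Longrightarrow> v' b = 0"
    using T.cuspidal_peak[OF n adm(2)] by auto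
  let ?A = "{w. w \<in> Poly_Mapping.keys f \<and> length w = ?d}"
  have le: "length w \<le> ?d" if "w \<in> Poly_Mapping.keys f" for w
    using lm_greatest[OF f(2) that] by (cases "w = lm f") (auto simp: word_less_iff)
  have zero: "v (map fst w) * v' (map snd w) = 0" if w: "w \<in> ?A" "w \<noteq> lm f" for w
  proof -
    have "(w, lm f) \<in> lex sym_less" using lm_greatest[OF f(2), of w] w by (auto simp: word_less_iff)
    moreover have "w \<in> lists (letters n)" using w f(1) qsym_ideal_carrier carrier_free_algebra by blast
    then have "map fst w \<in> T.tuples ?d" "map snd w \<in> T.tuples ?d" using w by (auto simp: T.tuples_def)
    ultimately show ?thesis using lex_sym_less_index_greater v(3) v'(3) by fastforce
  qed
  have "0 = (\<Sum>w\<in>?A. Poly_Mapping.lookup f w * complex_of_real (v (map fst w) * v' (map snd w)))"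
    using qsym_ideal_top_degree[OF f(1) le v(1) v'(1), of "map snd (lm f)"]
      T.admissible_tuples[OF adm(2)] v'(2) by simp
  also have "\<dots> = (\<Sum>w\<in>{lm f}. Poly_Mapping.lookup f w * complex_of_real (v (map fst w) * v' (map snd w)))"
    using lm_in_keys[OF f(2)] zero by (intro sum.mono_neutral_right) auto
  also have "\<dots> = Poly_Mapping.lookup f (lm f)" using v(2) v'(2) by simp
  finally show False using lm_in_keys[OF f(2)] by (simp add: in_keys_iff)
qed

section \<open>Leading monomials of the generators\<close>

definition below :: "word \<Rightarrow> ncpoly set" where
  "below w = {f. \<forall>v\<in>Poly_Mapping.keys f. (v, w) \<in> word_less}"

lemma below_single: "(v, w) \<in> word_less \<Longrightarrow> Poly_Mapping.single v c \<in> below w"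
  by (simp add: below_def)

lemma below_add: "f \<in> below w \<Longrightarrow> g \<in> below w \<Longrightarrow> f + g \<in> below w"
  unfolding below_def using Poly_Mapping.keys_add[of f g] by blast

lemma below_diff: "f \<in> below w \<Longrightarrow> g \<in> below w \<Longrightarrow> f - g \<in> below w"
  unfolding below_def using keys_diff[of f g] by blast

lemma below_sum: "(\<And>k. k \<in> A \<Longrightarrow> h k \<in> below w) \<Longrightarrow> sum h A \<in> below w"
  unfolding below_def using keys_sum[of h A] by blast

lemma below_one: "w \<noteq> [] \<Longrightarrow> 1 \<in> below w"
  unfolding single_one[symmetric] by (intro below_single) (cases w; simp add: zero_list_def word_less_iff)

lemmas below_intros = below_single below_add below_diff below_sum below_one

lemma lm_lc_eqI:
  assumes "f = Poly_Mapping.single w 1 + r" "r \<in> below w"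
  shows "lm f = w \<and> lc f = 1"
proof -
  have r: "Poly_Mapping.lookup r w = 0"
    using assms(2) word_less_irrefl[of w] by (auto simp: below_def in_keys_iff)
  have 1: "Poly_Mapping.lookup f w = 1" by (simp add: assms(1) lookup_add r)
  have "lm f = w"
  proof (rule lm_eqI)
    show "w \<in> Poly_Mapping.keys f" using 1 by (simp add: in_keys_iff)
    show "(v, w) \<in> word_less" if "v \<in> Poly_Mapping.keys f" "v \<noteq> w" for v
    proof -
      have "v \<in> Poly_Mapping.keys r"
        using that by (simp add: assms(1) in_keys_iff lookup_add lookup_single)
      then show ?thesis using assms(2) by (simp add: below_def)
    qed
  qed
  with 1 show ?thesis by (simp add: lc_def)
qed

lemma lm_cs:
  assumes "n \<ge> 1" shows "lm (cs n j) = [(1, j)] \<and> lc (cs n j) = 1"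
proof (rule lm_lc_eqI)
  show "cs n j = Poly_Mapping.single [(1, j)] 1 + ((\<Sum>\<alpha>=2..n. Poly_Mapping.single [(\<alpha>, j)] 1) - 1)"
    using assms by (simp add: cs_def u_def sum.atLeast_Suc_atMost numeral_2_eq_2)
  show "(\<Sum>\<alpha>=2..n. Poly_Mapping.single [(\<alpha>, j)] 1) - 1 \<in> below [(1, j)]"
    by (intro below_intros) (auto simp: word_less_iff)
qed

lemma lm_rs:
  assumes "n \<ge> 1" shows "lm (rs n i) = [(i, 1)] \<and> lc (rs n i) = 1"
proof (rule lm_lc_eqI)
  show "rs n i = Poly_Mapping.single [(i, 1)] 1 + ((\<Sum>\<alpha>=2..n. Poly_Mapping.single [(i, \<alpha>)] 1) - 1)"
    using assms by (simp add: rs_def u_def sum.atLeast_Suc_atMost numeral_2_eq_2)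
  show "(\<Sum>\<alpha>=2..n. Poly_Mapping.single [(i, \<alpha>)] 1) - 1 \<in> below [(i, 1)]"
    by (intro below_intros) (auto simp: word_less_iff)
qed

lemma lm_ip: "lm (ip i j) = [(i, j), (i, j)] \<and> lc (ip i j) = 1"
proof (rule lm_lc_eqI)
  show "ip i j = Poly_Mapping.single [(i, j), (i, j)] 1 + (0 - Poly_Mapping.single [(i, j)] 1)"
    by (simp add: ip_def power2_eq_square u_mult_u) (simp add: u_def)
  show "0 - Poly_Mapping.single [(i, j)] 1 \<in> below [(i, j), (i, j)]"
    by (simp add: below_def word_less_iff)
qed

lemma lm_single: "lm (Poly_Mapping.single w 1) = w \<and> lc (Poly_Mapping.single w 1) = 1"
  by (rule lm_lc_eqI[of _ _ 0]) (auto simp: below_def)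

lemma lm_rinj:
  assumes "n \<ge> 3" shows "lm (rinj n k j) = [(k, 2), (j, 3)] \<and> lc (rinj n k j) = 1"
proof (rule lm_lc_eqI)
  show "rinj n k j = Poly_Mapping.single [(k, 2), (j, 3)] 1 +
     ((\<Sum>\<alpha>=4..n. Poly_Mapping.single [(k, 2), (j, \<alpha>)] 1) - (\<Sum>\<alpha>=3..n. Poly_Mapping.single [(k, \<alpha>), (j, 1)] 1)
       + Poly_Mapping.single [(j, 1)] 1 - Poly_Mapping.single [(k, 2)] 1)" (is "_ = _ + ?r")
    using assms unfolding rinj_def u_mult_u
    by (subst sum.atLeast_Suc_atMost) (simp_all add: u_def)
  show "?r \<in> below [(k, 2), (j, 3)]"
    by (intro below_intros) (auto simp: word_less_iff)
qed

lemma lm_rwel: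
  assumes "n \<ge> 3" shows "lm (rwel n k j) = [(2, k), (3, j)] \<and> lc (rwel n k j) = 1"
proof (rule lm_lc_eqI)
  show "rwel n k j = Poly_Mapping.single [(2, k), (3, j)] 1 +
     ((\<Sum>\<alpha>=4..n. Poly_Mapping.single [(2, k), (\<alpha>, j)] 1) - (\<Sum>\<alpha>=3..n. Poly_Mapping.single [(\<alpha>, k), (1, j)] 1)
       + Poly_Mapping.single [(1, j)] 1 - Poly_Mapping.single [(2, k)] 1)" (is "_ = _ + ?r")
    using assms unfolding rwel_def u_mult_u
    by (subst sum.atLeast_Suc_atMost) (simp_all add: u_def)
  show "?r \<in> below [(2, k), (3, j)]"
    by (intro below_intros) (auto simp: word_less_iff)
qed

lemma single_mult_u: "Poly_Mapping.single w 1 * u i j = Poly_Mapping.single (w @ [(i, j)]) 1"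
  by (simp add: u_def mult_single plus_list_def)

lemma u_mult_single: "u i j * Poly_Mapping.single w 1 = Poly_Mapping.single ((i, j) # w) 1"
  by (simp add: u_def mult_single plus_list_def)

text \<open>The word \<open>[(k, 2), (j, 3), (i, 3)]\<close> cancels between the two products, and
  the summand for 4 takes the lead; it exists since n is at least 4. \<open>lm_rwel_u\<close> is the
  transposed case.\<close>

lemma lm_rinj_u:
  assumes "n \<ge> 4"
  shows "lm (rinj n k j * u i 3 - u k 2 * inj_rel j 3 i) = [(k, 2), (j, 4), (i, 3)] \<and>
     lc (rinj n k j * u i 3 - u k 2 * inj_rel j 3 i) = 1"
proof (rule lm_lc_eqI)
  let ?r = "(\<Sum>\<alpha>=5..n. Poly_Mapping.single [(k, 2), (j, \<alpha>), (i, 3)] 1)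
     - (\<Sum>\<alpha>=3..n. Poly_Mapping.single [(k, \<alpha>), (j, 1), (i, 3)] 1)
     + Poly_Mapping.single [(j, 1), (i, 3)] 1 - Poly_Mapping.single [(k, 2), (i, 3)] 1 :: ncpoly"
  have *: "(\<Sum>\<alpha>=3..n. h \<alpha>) = h 3 + (h 4 + (\<Sum>\<alpha>=5..n. h \<alpha>))" for h :: "nat \<Rightarrow> ncpoly"
    using assms by (subst sum.atLeast_Suc_atMost, simp, subst sum.atLeast_Suc_atMost) simp_all
  show "rinj n k j * u i 3 - u k 2 * inj_rel j 3 i = Poly_Mapping.single [(k, 2), (j, 4), (i, 3)] 1 + ?r"
    unfolding rinj_def inj_rel_def u_mult_u u_mult_single
    by (simp add: left_diff_distrib distrib_right sum_distrib_right single_mult_u u_mult_u * del: sum.cl_ivl_Suc)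
  show "?r \<in> below [(k, 2), (j, 4), (i, 3)]"
    by (intro below_intros) (auto simp: word_less_iff)
qed

lemma lm_rwel_u:
  assumes "n \<ge> 4"
  shows "lm (rwel n k j * u 3 i - u 2 k * wel_rel 3 j i) = [(2, k), (4, j), (3, i)] \<and>
     lc (rwel n k j * u 3 i - u 2 k * wel_rel 3 j i) = 1"
proof (rule lm_lc_eqI)
  let ?r = "(\<Sum>\<alpha>=5..n. Poly_Mapping.single [(2, k), (\<alpha>, j), (3, i)] 1)
     - (\<Sum>\<alpha>=3..n. Poly_Mapping.single [(\<alpha>, k), (1, j), (3, i)] 1)
     + Poly_Mapping.single [(1, j), (3, i)] 1 - Poly_Mapping.single [(2, k), (3, i)] 1 :: ncpoly"
  have *: "(\<Sum>\<alpha>=3..n. h \<alpha>) = h 3 + (h 4 + (\<Sum>\<alpha>=5..n. h \<alpha>))" for h :: "nat \<Rightarrow> ncpoly"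
    using assms by (subst sum.atLeast_Suc_atMost, simp, subst sum.atLeast_Suc_atMost) simp_all
  show "rwel n k j * u 3 i - u 2 k * wel_rel 3 j i = Poly_Mapping.single [(2, k), (4, j), (3, i)] 1 + ?r"
    unfolding rwel_def wel_rel_def u_mult_u u_mult_single
    by (simp add: left_diff_distrib distrib_right sum_distrib_right single_mult_u u_mult_u * del: sum.cl_ivl_Suc)
  show "?r \<in> below [(2, k), (4, j), (3, i)]"
    by (intro below_intros) (auto simp: word_less_iff)
qed

section \<open>The Groebner basis\<close>

lemma qsym_ideal_closed:
  "f \<in> qsym_ideal n \<Longrightarrow> g \<in> qsym_ideal n \<Longrightarrow> f + g \<in> qsym_ideal n"
  "f \<in> qsym_ideal n \<Longrightarrow> g \<in> qsym_ideal n \<Longrightarrow> f - g \<in> qsym_ideal n"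
  "f \<in> qsym_ideal n \<Longrightarrow> h \<in> carrier (free_algebra n) \<Longrightarrow> h * f \<in> qsym_ideal n"
  "f \<in> qsym_ideal n \<Longrightarrow> h \<in> carrier (free_algebra n) \<Longrightarrow> f * h \<in> qsym_ideal n"
proof -
  interpret I: ideal "qsym_ideal n" "free_algebra n" by (rule qsym_ideal_ideal)
  show add: "f \<in> qsym_ideal n \<Longrightarrow> g \<in> qsym_ideal n \<Longrightarrow> f + g \<in> qsym_ideal n" for f g
    using additive_subgroup.a_closed[OF I.is_additive_subgroup, of f g] by (simp add: free_algebra_def)
  show "f \<in> qsym_ideal n \<Longrightarrow> h \<in> carrier (free_algebra n) \<Longrightarrow> h * f \<in> qsym_ideal n"
    using I.I_l_closed[of f h] by (simp add: free_algebra_def)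
  show r: "f \<in> qsym_ideal n \<Longrightarrow> h \<in> carrier (free_algebra n) \<Longrightarrow> f * h \<in> qsym_ideal n" for f h
    using I.I_r_closed[of f h] by (simp add: free_algebra_def)
  have "- 1 \<in> carrier (free_algebra n)"
    using carrier_free_algebra_intros(4) by (simp add: carrier_free_algebra)
  then show "f \<in> qsym_ideal n \<Longrightarrow> g \<in> qsym_ideal n \<Longrightarrow> f - g \<in> qsym_ideal n"
    using add[of f "g * - 1"] r[of g "- 1"] by simp
qed

lemma symmetry_relations_qsym_ideal: "symmetry_relations n \<subseteq> qsym_ideal n"
  unfolding qsym_ideal_def
  by (intro ring.genideal_self ring_free_algebra symmetry_relations_carrier)

lemma
  shows rs_in_qsym_ideal: "i \<in> {1..n} \<Longrightarrow> rs n i \<in> qsym_ideal n"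
    and cs_in_qsym_ideal: "i \<in> {1..n} \<Longrightarrow> cs n i \<in> qsym_ideal n"
    and ip_in_qsym_ideal: "i \<in> {1..n} \<Longrightarrow> j \<in> {1..n} \<Longrightarrow> ip i j \<in> qsym_ideal n"
    and inj_rel_in_qsym_ideal:
      "i \<in> {1..n} \<Longrightarrow> j \<in> {1..n} \<Longrightarrow> k \<in> {1..n} \<Longrightarrow> j \<noteq> k \<Longrightarrow> inj_rel j i k \<in> qsym_ideal n"
    and wel_rel_in_qsym_ideal:
      "i \<in> {1..n} \<Longrightarrow> j \<in> {1..n} \<Longrightarrow> k \<in> {1..n} \<Longrightarrow> j \<noteq> k \<Longrightarrow> wel_rel i j k \<in> qsym_ideal n"
  by (rule subsetD[OF symmetry_relations_qsym_ideal], unfold symmetry_relations_def, blast)+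

lemma sum_split_two: "n \<ge> 2 \<Longrightarrow> (\<Sum>\<alpha>=1..n. h \<alpha>) = h 1 + (h 2 + (\<Sum>\<alpha>=3..n. h \<alpha>))"
  for h :: "nat \<Rightarrow> 'a :: comm_monoid_add"
  by (subst sum.atLeast_Suc_atMost, simp, subst sum.atLeast_Suc_atMost) (simp_all add: numeral_3_eq_3 numeral_2_eq_2)

text \<open>In \<open>u j 2 * rs n k - rs n j * u k 1\<close> the overlap
  \<open>u j 2 * u k 1\<close> cancels; the remaining products within columns 1 and 2 are removed by
  \<open>inj_rel\<close>.\<close>

lemma rinj_eq:
  assumes "n \<ge> 2"
  shows "rinj n j k = u j 2 * rs n k - rs n j * u k 1 - inj_rel j 2 k + inj_rel j 1 k"
  unfolding rinj_def rs_def inj_rel_def sum_split_two[OF assms]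
  by (simp add: algebra_simps sum_distrib_left sum_distrib_right del: sum.cl_ivl_Suc)

lemma rwel_eq:
  assumes "n \<ge> 2"
  shows "rwel n j k = u 2 j * cs n k - cs n j * u 1 k - wel_rel 2 j k + wel_rel 1 j k"
  unfolding rwel_def cs_def wel_rel_def sum_split_two[OF assms]
  by (simp add: algebra_simps sum_distrib_left sum_distrib_right del: sum.cl_ivl_Suc)

lemma rinj_in_qsym_ideal:
  assumes "n \<ge> 2" "j \<in> {1..n}" "k \<in> {1..n}" "j \<noteq> k"
  shows "rinj n j k \<in> qsym_ideal n"
  unfolding rinj_eq[OF assms(1)]
  using assms
  by (intro qsym_ideal_closed(1)[OF qsym_ideal_closed(2)[OF qsym_ideal_closed(2)[OF qsym_ideal_closed(3,4)]]]
      rs_in_qsym_ideal inj_rel_in_qsym_ideal carrier_free_algebra_intros) auto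

lemma rwel_in_qsym_ideal:
  assumes "n \<ge> 2" "j \<in> {1..n}" "k \<in> {1..n}" "j \<noteq> k"
  shows "rwel n j k \<in> qsym_ideal n"
  unfolding rwel_eq[OF assms(1)]
  using assms
  by (intro qsym_ideal_closed(1)[OF qsym_ideal_closed(2)[OF qsym_ideal_closed(2)[OF qsym_ideal_closed(3,4)]]]
      cs_in_qsym_ideal wel_rel_in_qsym_ideal carrier_free_algebra_intros) auto

lemma qsym_G_subset_qsym_ideal:
  assumes "n \<ge> 3" shows "qsym_G n \<subseteq> qsym_ideal n"
proof -
  have "qsym_G1 n \<subseteq> qsym_ideal n"
    using assms by (auto simp: qsym_G1_def intro: cs_in_qsym_ideal)
  moreover have "qsym_G2 n \<subseteq> qsym_ideal n"
    unfolding qsym_G2_def using assms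
    by (auto intro!: cs_in_qsym_ideal rs_in_qsym_ideal ip_in_qsym_ideal inj_rel_in_qsym_ideal
        wel_rel_in_qsym_ideal rinj_in_qsym_ideal rwel_in_qsym_ideal)
  moreover have "qsym_G3 n \<subseteq> qsym_ideal n"
    unfolding qsym_G3_def using assms
    by (auto intro!: qsym_ideal_closed(2)[OF qsym_ideal_closed(4,3)] carrier_free_algebra_intros inj_rel_in_qsym_ideal rinj_in_qsym_ideal)
  moreover have "qsym_G4 n \<subseteq> qsym_ideal n"
    unfolding qsym_G4_def using assms
    by (auto intro!: qsym_ideal_closed(2)[OF qsym_ideal_closed(4,3)] carrier_free_algebra_intros wel_rel_in_qsym_ideal rwel_in_qsym_ideal)
  ultimately show ?thesis unfolding qsym_G_def by blast
qed

section \<open>The generators indexed by their leading words\<close>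

definition index_pairs :: "nat \<Rightarrow> (nat \<times> nat) set" where
  "index_pairs n = (SIGMA k:{2..n}. {2..n} - {k})"

text \<open>A pair (2, 3) inside such a triple would make the resulting three-symbol word divisible
  by a leading word of \<open>rwel\<close> or \<open>rinj\<close>.\<close>

definition index_triples :: "nat \<Rightarrow> (nat \<times> nat \<times> nat) set" where
  "index_triples n = {(k, j, i). (k, j) \<in> index_pairs n - {(2, 3)} \<and> (j, i) \<in> index_pairs n - {(2, 3)}}"

text \<open>The third family joins \<open>ip\<close> and \<open>wel_rel\<close>. The exclusions of
  (2, 3) and (2, 4, 3) in the \<open>rwel\<close> families drop words which the \<open>rinj\<close>
  families already contain, those with equal row and column words.\<close>

definition leading_words :: "nat \<Rightarrow> word set" where
  "leading_words n =
     (\<lambda>j. [(1, j)]) ` {1..n} \<union>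
     (\<lambda>i. [(i, 1)]) ` {2..n} \<union>
     (\<lambda>(i, j, k). [(i, j), (i, k)]) ` ({2..n} \<times> {2..n} \<times> {2..n}) \<union>
     (\<lambda>((i, k), j). [(i, j), (k, j)]) ` (index_pairs n \<times> {2..n}) \<union>
     (\<lambda>(k, j). [(k, 2), (j, 3)]) ` index_pairs n \<union>
     (\<lambda>(k, j). [(2, k), (3, j)]) ` (index_pairs n - {(2, 3)}) \<union>
     (\<lambda>(k, j, i). [(k, 2), (j, 4), (i, 3)]) ` index_triples n \<union>
     (\<lambda>(k, j, i). [(2, k), (4, j), (3, i)]) ` (index_triples n - {(2, 4, 3)})"

text \<open>On \<open>leading_words\<close> this is a right inverse of \<open>lm\<close>. The order
  of the tests gives the words shared by both families to \<open>rinj\<close>.\<close>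

fun generator :: "nat \<Rightarrow> word \<Rightarrow> ncpoly" where
  "generator n [(i, j)] = (if i = 1 then cs n j else rs n i)"
| "generator n [(i, j), (k, l)] =
     (if i = k then (if j = l then ip i j else wel_rel i j l)
      else if j = l then inj_rel i j k
      else if j = 2 \<and> l = 3 then rinj n i k else rwel n j l)"
| "generator n [(k, a), (j, b), (i, c)] =
     (if a = 2 \<and> b = 4 \<and> c = 3 then rinj n k j * u i 3 - u k 2 * inj_rel j 3 i
      else rwel n a b * u 3 c - u 2 a * wel_rel 3 b c)"
| "generator n _ = 0"

lemma leading_words_cases [consumes 1]:
  assumes "w \<in> leading_words n"
  obtains (cs) j where "w = [(1, j)]" "j \<in> {1..n}"
  | (rs) i where "w = [(i, 1)]" "i \<in> {2..n}"
  | (row) i j k where "w = [(i, j), (i, k)]" "i \<in> {2..n}" "j \<in> {2..n}" "k \<in> {2..n}"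
  | (col) i j k where "w = [(i, j), (k, j)]" "i \<in> {2..n}" "j \<in> {2..n}" "k \<in> {2..n}" "i \<noteq> k"
  | (rinj) k j where "w = [(k, 2), (j, 3)]" "j \<in> {2..n}" "k \<in> {2..n}" "k \<noteq> j"
  | (rwel) k j where "w = [(2, k), (3, j)]" "j \<in> {2..n}" "k \<in> {2..n}" "k \<noteq> j" "(k, j) \<noteq> (2, 3)"
  | (rinj_u) k j i where "w = [(k, 2), (j, 4), (i, 3)]" "i \<in> {2..n}" "j \<in> {2..n}" "k \<in> {2..n}"
      "k \<noteq> j" "j \<noteq> i" "(k, j) \<noteq> (2, 3)" "(j, i) \<noteq> (2, 3)"
  | (rwel_u) k j i where "w = [(2, k), (4, j), (3, i)]" "i \<in> {2..n}" "j \<in> {2..n}" "k \<in> {2..n}"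
      "k \<noteq> j" "j \<noteq> i" "(k, j) \<noteq> (2, 3)" "(j, i) \<noteq> (2, 3)" "(k, j, i) \<noteq> (2, 4, 3)"
proof -
  note U = assms[unfolded leading_words_def Un_iff]
  from U show ?thesis
    apply (elim disjE)
    subgoal using cs by (elim imageE) simp
    subgoal using rs by (elim imageE) simp
    subgoal using row by (elim imageE) (clarsimp; blast)
    subgoal using col by (elim imageE) (clarsimp simp: index_pairs_def; blast)
    subgoal using rinj by (elim imageE) (clarsimp simp: index_pairs_def; blast)
    subgoal using rwel by (elim imageE) (clarsimp simp: index_pairs_def; blast)
    subgoal using rinj_u by (elim imageE) (clarsimp simp: index_pairs_def index_triples_def; blast)
    subgoal using rwel_u by (elim imageE) (clarsimp simp: index_pairs_def index_triples_def; blast)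
    done
qed

lemma leading_words_intros:
  "j \<in> {1..n} \<Longrightarrow> [(1, j)] \<in> leading_words n"
  "i \<in> {2..n} \<Longrightarrow> [(i, 1)] \<in> leading_words n"
  "i \<in> {2..n} \<Longrightarrow> j \<in> {2..n} \<Longrightarrow> k \<in> {2..n} \<Longrightarrow> [(i, j), (i, k)] \<in> leading_words n"
  "i \<in> {2..n} \<Longrightarrow> j \<in> {2..n} \<Longrightarrow> k \<in> {2..n} \<Longrightarrow> i \<noteq> k \<Longrightarrow> [(i, j), (k, j)] \<in> leading_words n"
  "j \<in> {2..n} \<Longrightarrow> k \<in> {2..n} \<Longrightarrow> k \<noteq> j \<Longrightarrow> [(k, 2), (j, 3)] \<in> leading_words n"
  "j \<in> {2..n} \<Longrightarrow> k \<in> {2..n} \<Longrightarrow> k \<noteq> j \<Longrightarrow> (k, j) \<noteq> (2, 3) \<Longrightarrow> [(2, k), (3, j)] \<in> leading_words n"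
  "(k, j, i) \<in> index_triples n \<Longrightarrow> [(k, 2), (j, 4), (i, 3)] \<in> leading_words n"
  "(k, j, i) \<in> index_triples n - {(2, 4, 3)} \<Longrightarrow> [(2, k), (4, j), (3, i)] \<in> leading_words n"
proof -
  show "j \<in> {1..n} \<Longrightarrow> [(1, j)] \<in> leading_words n" "i \<in> {2..n} \<Longrightarrow> [(i, 1)] \<in> leading_words n"
    unfolding leading_words_def by blast+
  show "i \<in> {2..n} \<Longrightarrow> j \<in> {2..n} \<Longrightarrow> k \<in> {2..n} \<Longrightarrow> [(i, j), (i, k)] \<in> leading_words n"
    using imageI[of "(i, j, k)" "{2..n} \<times> {2..n} \<times> {2..n}" "\<lambda>(i, j, k). [(i, j), (i, k)]", unfolded prod.case]
    unfolding leading_words_def by blast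
  show "i \<in> {2..n} \<Longrightarrow> j \<in> {2..n} \<Longrightarrow> k \<in> {2..n} \<Longrightarrow> i \<noteq> k \<Longrightarrow> [(i, j), (k, j)] \<in> leading_words n"
    using imageI[of "((i, k), j)" "index_pairs n \<times> {2..n}" "\<lambda>((i, k), j). [(i, j), (k, j)]", unfolded prod.case]
    unfolding leading_words_def index_pairs_def by blast
  show "j \<in> {2..n} \<Longrightarrow> k \<in> {2..n} \<Longrightarrow> k \<noteq> j \<Longrightarrow> [(k, 2), (j, 3)] \<in> leading_words n"
    using imageI[of "(k, j)" "index_pairs n" "\<lambda>(k, j). [(k, 2), (j, 3)]", unfolded prod.case]
    unfolding leading_words_def index_pairs_def by blast
  show "j \<in> {2..n} \<Longrightarrow> k \<in> {2..n} \<Longrightarrow> k \<noteq> j \<Longrightarrow> (k, j) \<noteq> (2, 3) \<Longrightarrow> [(2, k), (3, j)] \<in> leading_words n"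
    using imageI[of "(k, j)" "index_pairs n - {(2, 3)}" "\<lambda>(k, j). [(2, k), (3, j)]", unfolded prod.case]
    unfolding leading_words_def index_pairs_def by blast
  show "(k, j, i) \<in> index_triples n \<Longrightarrow> [(k, 2), (j, 4), (i, 3)] \<in> leading_words n"
    using imageI[of "(k, j, i)" "index_triples n" "\<lambda>(k, j, i). [(k, 2), (j, 4), (i, 3)]", unfolded prod.case]
    unfolding leading_words_def by blast
  show "(k, j, i) \<in> index_triples n - {(2, 4, 3)} \<Longrightarrow> [(2, k), (4, j), (3, i)] \<in> leading_words n"
    using imageI[of "(k, j, i)" "index_triples n - {(2, 4, 3)}" "\<lambda>(k, j, i). [(2, k), (4, j), (3, i)]", unfolded prod.case]
    unfolding leading_words_def by blast
qed

text \<open>With \<open>lm_generator\<close>, this turns monicity, reducedness and the cardinality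
  into statements about words.\<close>

lemma qsym_G_eq_generator: "qsym_G n = generator n ` leading_words n" if "n \<ge> 4"
proof
  show "generator n ` leading_words n \<subseteq> qsym_G n"
  proof (rule image_subsetI)
    fix w assume "w \<in> leading_words n"
    then show "generator n w \<in> qsym_G n"
    proof (cases rule: leading_words_cases)
      case (cs j)
      then have "j = 1 \<or> j \<in> {2..n}" by auto
      with cs show ?thesis by (auto simp: qsym_G_def qsym_G1_def qsym_G2_def)
    next
      case (rs i)
      then have "generator n w = rs n i" by auto
      with rs(2) show ?thesis unfolding qsym_G_def qsym_G2_def by blast
    next
      case (row i j k)
      show ?thesis
      proof (cases "j = k")
        case True
        then have "generator n w = ip i j" using row by auto
        with row show ?thesis unfolding qsym_G_def qsym_G2_def by blast
      next
        case False
        then have "generator n w = wel_rel i j k" using row by auto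
        with row False show ?thesis unfolding qsym_G_def qsym_G2_def by blast
      qed
    next
      case (col i j k)
      then have "generator n w = inj_rel i j k" by auto
      with col show ?thesis unfolding qsym_G_def qsym_G2_def by blast
    next
      case (rinj k j)
      then have "generator n w = rinj n k j" by auto
      with rinj show ?thesis unfolding qsym_G_def qsym_G2_def by blast
    next
      case (rwel k j)
      then have "generator n w = rwel n k j" by auto
      with rwel show ?thesis unfolding qsym_G_def qsym_G2_def by blast
    next
      case (rinj_u k j i)
      then have "generator n w = rinj n k j * u i 3 - u k 2 * inj_rel j 3 i" by auto
      with rinj_u show ?thesis unfolding qsym_G_def qsym_G3_def by blast
    next
      case (rwel_u k j i)
      then have "generator n w = rwel n k j * u 3 i - u 2 k * wel_rel 3 j i" by auto
      with rwel_u show ?thesis unfolding qsym_G_def qsym_G4_def by blast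
    qed
  qed
  have wit: "f \<in> generator n ` leading_words n" if "w \<in> leading_words n" "generator n w = f" for f w
    using that by blast
  have cs: "cs n i \<in> generator n ` leading_words n" if "i \<in> {1..n}" for i
    using wit[OF leading_words_intros(1)[OF that]] by simp
  have "qsym_G1 n \<subseteq> generator n ` leading_words n"
    using that cs[of 1] by (simp add: qsym_G1_def)
  moreover have "qsym_G2 n \<subseteq> generator n ` leading_words n"
  proof -
    have fam1: "cs n i \<in> generator n ` leading_words n" if "i \<in> {2..n}" for i
      using cs[of i] that by auto
    have fam2: "rs n i \<in> generator n ` leading_words n" if "i \<in> {2..n}" for i
      using that by (intro wit[OF leading_words_intros(2)[of i]]) auto
    have fam3: "ip i j \<in> generator n ` leading_words n" if "i \<in> {2..n}" "j \<in> {2..n}" for i j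
      using that by (intro wit[OF leading_words_intros(3)[of i n j j]]) auto
    have fam4: "inj_rel i j k \<in> generator n ` leading_words n"
      if "i \<in> {2..n}" "j \<in> {2..n}" "k \<in> {2..n}" "i \<noteq> k" for i j k
      using that by (intro wit[OF leading_words_intros(4)[of i n j k]]) auto
    have fam5: "wel_rel i j k \<in> generator n ` leading_words n"
      if "i \<in> {2..n}" "j \<in> {2..n}" "k \<in> {2..n}" "j \<noteq> k" for i j k
      using that by (intro wit[OF leading_words_intros(3)[of i n j k]]) auto
    have fam6: "rinj n k j \<in> generator n ` leading_words n"
      if "j \<in> {2..n}" "k \<in> {2..n}" "k \<noteq> j" for j k
      using that by (intro wit[OF leading_words_intros(5)[of j n k]]) auto
    have fam7: "rwel n k j \<in> generator n ` leading_words n"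
      if "j \<in> {2..n}" "k \<in> {2..n}" "k \<noteq> j" "(k, j) \<noteq> (2, 3)" for j k
      using that by (intro wit[OF leading_words_intros(6)[of j n k]]) auto
    show ?thesis
      unfolding qsym_G2_def
      by (intro Un_least subsetI; elim CollectE exE conjE; hypsubst;
          rule fam1 fam2 fam3 fam4 fam5 fam6 fam7; assumption)
  qed
  moreover have "qsym_G3 n \<subseteq> generator n ` leading_words n"
  proof -
    have "rinj n k j * u i 3 - u k 2 * inj_rel j 3 i \<in> generator n ` leading_words n"
      if "(k, j, i) \<in> index_triples n" for i j k
      by (rule wit[OF leading_words_intros(7)[OF that]]) simp
    then show ?thesis unfolding qsym_G3_def index_triples_def index_pairs_def by blast
  qed
  moreover have "qsym_G4 n \<subseteq> generator n ` leading_words n"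
  proof -
    have "rwel n k j * u 3 i - u 2 k * wel_rel 3 j i \<in> generator n ` leading_words n"
      if "(k, j, i) \<in> index_triples n - {(2, 4, 3)}" for i j k
      by (rule wit[OF leading_words_intros(8)[OF that]]) (use that in auto)
    then show ?thesis unfolding qsym_G4_def index_triples_def index_pairs_def by blast
  qed
  ultimately show "qsym_G n \<subseteq> generator n ` leading_words n"
    unfolding qsym_G_def by blast
qed

lemma lm_generator:
  assumes "n \<ge> 4" "w \<in> leading_words n"
  shows "lm (generator n w) = w \<and> lc (generator n w) = 1"
  using assms(2)
proof (cases rule: leading_words_cases)
  case (row i j k)
  then show ?thesis using lm_ip lm_single by (simp add: wel_rel_def u_mult_u)
next
  case (col i j k)
  then show ?thesis using lm_single by (simp add: inj_rel_def u_mult_u)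
qed (use assms(1) lm_cs[of n] lm_rs[of n] lm_rinj[of n] lm_rwel[of n] lm_rinj_u[of n] lm_rwel_u[of n] in auto)

text \<open>One-symbol leading words contain the index 1, which longer ones lack. Two-symbol ones
  repeat a row or column index or have 23 as row or column word; neighbours in three-symbol ones do
  neither.\<close>

lemma sublist_leading_words:
  assumes "v \<in> leading_words n" "w \<in> leading_words n" "sublist v w"
  shows "v = w"
proof -
  consider "length v = length w" | x where "v = [x]" "2 \<le> length w" | x y where "v = [x, y]" "length w = 3"
    using assms(1,2) sublist_length_le[OF assms(3)]
    by (elim leading_words_cases) auto
  then show ?thesis
  proof cases
    case 1
    then show ?thesis using assms(3) by (auto simp: sublist_def)
  next
    case 2
    then have "fst x = 1 \<or> snd x = 1" using assms(1) by (elim leading_words_cases) auto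
    moreover have "x \<in> set w" using assms(3) 2 set_mono_sublist by fastforce
    moreover have "\<forall>x\<in>set w. 2 \<le> fst x \<and> 2 \<le> snd x" using assms(2) 2(2) by (elim leading_words_cases) auto
    ultimately show ?thesis by force
  next
    case 3
    have x: "fst x = fst y \<or> snd x = snd y \<or> snd x = 2 \<and> snd y = 3 \<or> fst x = 2 \<and> fst y = 3"
      using assms(1) 3 by (elim leading_words_cases) auto
    obtain a b c where w: "w = [a, b, c]" using 3(2) by (auto simp: numeral_3_eq_3 length_Suc_conv)
    then have "x = a \<and> y = b \<or> x = b \<and> y = c"
      using assms(3) 3(1) by (auto simp: sublist_Cons_right)
    moreover have "\<not> (fst a = fst b \<or> snd a = snd b \<or> snd a = 2 \<and> snd b = 3 \<or> fst a = 2 \<and> fst b = 3)"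
      "\<not> (fst b = fst c \<or> snd b = snd c \<or> snd b = 2 \<and> snd c = 3 \<or> fst b = 2 \<and> fst c = 3)"
      using assms(2)[unfolded w] by (cases rule: leading_words_cases; simp)+
    ultimately show ?thesis using x by blast
  qed
qed

section \<open>Words avoiding all leading words\<close>

lemma sublist_nth_Suc:
  assumes "Suc i < length w" shows "sublist [w ! i, w ! Suc i] w"
proof -
  have "drop i w = [w ! i, w ! Suc i] @ drop (Suc (Suc i)) w"
    using assms by (simp add: Cons_nth_drop_Suc)
  then have "w = take i w @ [w ! i, w ! Suc i] @ drop (Suc (Suc i)) w"
    using append_take_drop_id[of i w] by simp
  then show ?thesis unfolding sublist_def by blast
qed

lemma sublist_map_pair:
  assumes "sublist [a, b] (map f w)"
  obtains x y where "sublist [x, y] w" "f x = a" "f y = b"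
proof -
  obtain ps ss where "map f w = ps @ [a, b] @ ss" using assms by (auto simp: sublist_def)
  then obtain ps' x y ss' where w: "w = ps' @ [x, y] @ ss'" "f x = a" "f y = b"
    by (auto simp: map_eq_append_conv map_eq_Cons_conv)
  moreover have "sublist [x, y] w" unfolding w(1) sublist_def by blast
  ultimately show ?thesis using that by blast
qed

lemma sublist_map_triple:
  assumes "sublist [a, b, c] (map f w)"
  obtains x y z where "sublist [x, y, z] w" "f x = a" "f y = b" "f z = c"
proof -
  obtain ps ss where "map f w = ps @ [a, b, c] @ ss" using assms by (auto simp: sublist_def)
  then obtain ps' x y z ss' where w: "w = ps' @ [x, y, z] @ ss'" "f x = a" "f y = b" "f z = c"
    by (auto simp: map_eq_append_conv map_eq_Cons_conv)
  moreover have "sublist [x, y, z] w" unfolding w(1) sublist_def by blast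
  ultimately show ?thesis using that by blast
qed

text \<open>Any violation of admissibility in one index word is located at a symbol, a pair or a
  triple of neighbouring symbols of \<open>w\<close>; that factor, or a shorter one inside it, is a
  leading word.\<close>

lemma admissible_if_no_leading_word:
  assumes n: "n \<ge> 4" and w: "w \<in> lists (letters n)"
    and no: "\<And>v. v \<in> leading_words n \<Longrightarrow> \<not> sublist v w"
  shows "tuple_space.admissible n (map fst w) \<and> tuple_space.admissible n (map snd w)"
proof -
  have letter: "fst x \<in> {2..n} \<and> snd x \<in> {2..n}" if mem: "x \<in> set w" for x
  proof -
    obtain i j where x: "x = (i, j)" "i \<in> {1..n}" "j \<in> {1..n}" using mem w by (cases x) auto
    have "sublist [x] w" using split_list[OF mem] by (auto simp: sublist_def)
    then have "[(i, j)] \<notin> leading_words n" using no x(1) by blast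
    then have "i \<noteq> 1" using leading_words_intros(1)[of j n] x by auto
    then have i: "i \<in> {2..n}" using x by auto
    then have "j \<noteq> 1"
      using leading_words_intros(2)[of i n] \<open>[(i, j)] \<notin> leading_words n\<close> by auto
    then show ?thesis using x i by auto
  qed
  have pair: "fst x \<noteq> fst y \<and> snd x \<noteq> snd y \<and> \<not> (snd x = 2 \<and> snd y = 3) \<and> \<not> (fst x = 2 \<and> fst y = 3)"
    if "sublist [x, y] w" for x y
  proof -
    obtain i j k l where x: "x = (i, j)" "y = (k, l)" by fastforce
    have N: "i \<in> {2..n}" "j \<in> {2..n}" "k \<in> {2..n}" "l \<in> {2..n}"
      using letter set_mono_sublist[OF that] x by auto
    have "[(i, j), (k, l)] \<notin> leading_words n" using no that x by blast
    \<comment> \<open>When rows and columns both read 23, the \<open>rwel\<close> family omits the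
      word but the \<open>rinj\<close> family supplies it.\<close>
    then show ?thesis
      using leading_words_intros(3)[of i n j l] leading_words_intros(4)[of i n j k]
        leading_words_intros(5)[of k n i] leading_words_intros(6)[of l n j] N x
      by (cases "j = l"; cases "j = 2 \<and> l = 3") auto
  qed
  have triple: "\<not> (snd x = 2 \<and> snd y = 4 \<and> snd z = 3) \<and> \<not> (fst x = 2 \<and> fst y = 4 \<and> fst z = 3)"
    if "sublist [x, y, z] w" for x y z
  proof -
    obtain i j k l p q where x: "x = (i, j)" "y = (k, l)" "z = (p, q)" by (metis surj_pair)
    have N: "i \<in> {2..n}" "j \<in> {2..n}" "k \<in> {2..n}" "l \<in> {2..n}" "p \<in> {2..n}" "q \<in> {2..n}"
      using letter set_mono_sublist[OF that] x by auto
    have "sublist [x, y] [x, y, z]" "sublist [y, z] [x, y, z]"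
      by (simp_all add: sublist_Cons_right)
    then have "sublist [x, y] w" "sublist [y, z] w"
      using that sublist_order.order_trans by blast+
    then have xy: "i \<noteq> k" "j \<noteq> l" "\<not> (j = 2 \<and> l = 3)" "\<not> (i = 2 \<and> k = 3)"
      "k \<noteq> p" "l \<noteq> q" "\<not> (l = 2 \<and> q = 3)" "\<not> (k = 2 \<and> p = 3)"
      using pair[of x y] pair[of y z] x by auto
    then have "(i, k, p) \<in> index_triples n" "(j, l, q) \<in> index_triples n"
      using N by (auto simp: index_triples_def index_pairs_def)
    moreover have "[(i, j), (k, l), (p, q)] \<notin> leading_words n" using no that x by blast
    ultimately show ?thesis
      using leading_words_intros(7)[of i k p n] leading_words_intros(8)[of j l q n] x by auto
  qed
  have "tuple_space.admissible n (map f w)" if f: "f = fst \<or> f = snd" for f :: "nat \<times> nat \<Rightarrow> nat"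
    unfolding tuple_space.admissible_def
  proof (intro conjI notI)
    show "set (map f w) \<subseteq> {2..n}" using letter f by auto
    show "distinct_adj (map f w)"
      unfolding distinct_adj_conv_nth
    proof (intro allI impI)
      fix i assume i: "Suc i < length (map f w)"
      then have "f (w ! i) \<noteq> f (w ! Suc i)"
        using pair[OF sublist_nth_Suc, of i] f by auto
      then show "map f w ! i \<noteq> map f w ! Suc i" using i by simp
    qed
  next
    assume "sublist [2, 3] (map f w)"
    then obtain x y where "sublist [x, y] w" "f x = 2" "f y = 3" by (rule sublist_map_pair)
    then show False using pair[of x y] f by auto
  next
    assume "sublist [2, 4, 3] (map f w)"
    then obtain x y z where "sublist [x, y, z] w" "f x = 2" "f y = 4" "f z = 3" by (rule sublist_map_triple)
    then show False using triple[of x y z] f by auto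
  qed
  then show ?thesis by blast
qed

section \<open>Counting the leading words\<close>

lemma card_index_pairs: "card (index_pairs (k + 4)) = (k + 3) * (k + 2)"
proof -
  have "card (index_pairs (k + 4)) = (\<Sum>j\<in>{2..k + 4}. card ({2..k + 4} - {j}))"
    unfolding index_pairs_def by (rule card_SigmaI) auto
  also have "\<dots> = (\<Sum>j\<in>{2..k + 4}. k + 2)"
    by (rule sum.cong) auto
  finally show ?thesis by simp
qed

text \<open>Triples are counted by their middle letter j, for which the first letter ranges over
  \<open>A j\<close> and the last over \<open>B j\<close> independently.\<close>

lemma card_index_triples: "card (index_triples (k + 4)) = 2 * (k + 1) * (k + 2) + (k + 1) * (k + 2)^2"
proof -
  let ?N = "{2..k + 4}"
  define A where "A j = ?N - {j} - (if j = 3 then {2} else {})" for j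
  define B where "B j = ?N - {j} - (if j = 2 then {3} else {})" for j
  have eq: "index_triples (k + 4) = (\<lambda>(j, k, i). (k, j, i)) ` (SIGMA j:?N. A j \<times> B j)"
    by (auto simp: index_triples_def index_pairs_def A_def B_def image_iff split: if_splits)
  have "card (index_triples (k + 4)) = card (SIGMA j:?N. A j \<times> B j)"
    unfolding eq by (rule card_image) (auto simp: inj_on_def)
  also have "\<dots> = (\<Sum>j\<in>?N. card (A j) * card (B j))"
    by (subst card_SigmaI) (auto simp: A_def B_def card_cartesian_product)
  \<comment> \<open>Only these two middle letters feel the exclusion of (2, 3): 3 cannot follow 2,
    and 2 cannot precede 3.\<close>
  also have "?N = {2, 3} \<union> {4..k + 4}" by auto
  also have "(\<Sum>j\<in>{2, 3} \<union> {4..k + 4}. card (A j) * card (B j)) =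
      (\<Sum>j\<in>{2, 3}. card (A j) * card (B j)) + (\<Sum>j\<in>{4..k + 4}. card (A j) * card (B j))"
    by (rule sum.union_disjoint) auto
  also have "(\<Sum>j\<in>{4..k + 4}. card (A j) * card (B j)) = (\<Sum>j\<in>{4..k + 4}. (k + 2)^2)"
    by (rule sum.cong) (auto simp: A_def B_def power2_eq_square)
  also have "(\<Sum>j\<in>{2, 3}. card (A j) * card (B j)) = 2 * (k + 1) * (k + 2)"
  proof -
    have "card (A 2) = k + 2" "card (B 3) = k + 2" by (simp_all add: A_def B_def)
    moreover have "card (B 2) = k + 1" "card (A 3) = k + 1"
      by (simp_all add: A_def B_def card_Diff_singleton)
    ultimately show ?thesis by simp
  qed
  finally show ?thesis by simp
qed

lemma finite_index_triples: "finite (index_triples n)"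
  by (rule finite_subset[of _ "{2..n} \<times> {2..n} \<times> {2..n}"]) (auto simp: index_triples_def index_pairs_def)

lemma finite_index_pairs: "finite (index_pairs n)"
  by (simp add: index_pairs_def)

lemma finite_leading_words: "finite (leading_words n)"
  by (simp add: leading_words_def finite_index_triples finite_index_pairs)

lemma card_leading_words:
  assumes "n \<ge> 4"
  shows "int (card (leading_words n)) = 4 * int n ^ 3 - 15 * int n ^ 2 + 16 * int n - 2"
proof -
  \<comment> \<open>Counting in terms of k keeps truncated subtraction out of the formulas.\<close>
  define k where "k = n - 4"
  have n: "n = k + 4" using assms by (simp add: k_def)
  let ?N = "{2..n}"
  define W1 where "W1 = (\<lambda>j. [(1 :: nat, j)]) ` {1..n}"
  define W2 where "W2 = (\<lambda>i. [(i, 1 :: nat)]) ` ?N"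
  define W3 where "W3 = (\<lambda>(i, j, k). [(i, j), (i, k)]) ` (?N \<times> ?N \<times> ?N)"
  define W4 where "W4 = (\<lambda>((i, k), j). [(i, j), (k, j)]) ` (index_pairs n \<times> ?N)"
  define W5 where "W5 = (\<lambda>(k, j). [(k, 2 :: nat), (j, 3 :: nat)]) ` index_pairs n"
  define W6 where "W6 = (\<lambda>(k, j). [(2 :: nat, k), (3 :: nat, j)]) ` (index_pairs n - {(2, 3)})"
  define W7 where "W7 = (\<lambda>(k, j, i). [(k, 2 :: nat), (j, 4 :: nat), (i, 3 :: nat)]) ` index_triples n"
  define W8 where "W8 = (\<lambda>(k, j, i). [(2 :: nat, k), (4 :: nat, j), (3 :: nat, i)]) ` (index_triples n - {(2, 4, 3)})"
  note W = W1_def W2_def W3_def W4_def W5_def W6_def W7_def W8_def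
  have LW: "leading_words n = W1 \<union> W2 \<union> W3 \<union> W4 \<union> W5 \<union> W6 \<union> W7 \<union> W8"
    unfolding leading_words_def W ..
  have fin: "finite W1" "finite W2" "finite W3" "finite W4" "finite W5" "finite W6" "finite W7" "finite W8"
    unfolding W by (simp_all add: finite_index_triples finite_index_pairs)
  have pairs: "i \<in> ?N" "j \<in> ?N" "i \<noteq> j" if "(i, j) \<in> index_pairs n" for i j
    using that by (auto simp: index_pairs_def)
  have "card (leading_words n) = card W1 + card W2 + card W3 + card W4 + card W5 + card W6 + card W7 + card W8"
  proof -
    have "W1 \<inter> W2 = {}" "(W1 \<union> W2) \<inter> W3 = {}" "(W1 \<union> W2 \<union> W3) \<inter> W4 = {}"
      "(W1 \<union> W2 \<union> W3 \<union> W4) \<inter> W5 = {}" "(W1 \<union> W2 \<union> W3 \<union> W4 \<union> W5) \<inter> W6 = {}"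
      "(W1 \<union> W2 \<union> W3 \<union> W4 \<union> W5 \<union> W6) \<inter> W7 = {}"
      "(W1 \<union> W2 \<union> W3 \<union> W4 \<union> W5 \<union> W6 \<union> W7) \<inter> W8 = {}"
      unfolding W by (auto dest: pairs)
    then show ?thesis unfolding LW using fin by (simp add: card_Un_disjoint)
  qed
  moreover have "card W1 = k + 4" "card W2 = k + 3" "card W3 = (k + 3)^3"
    unfolding W1_def W2_def W3_def
    by (subst card_image; auto simp: inj_on_def n card_cartesian_product power3_eq_cube algebra_simps)+
  moreover have "card W4 = (k + 3) * (k + 2) * (k + 3)" "card W5 = (k + 3) * (k + 2)"
    unfolding W4_def W5_def
    by (subst card_image; auto simp: inj_on_def n card_cartesian_product card_index_pairs)+
  moreover have "int (card W6) = (k + 3) * (k + 2) - 1"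
  proof -
    have "card W6 = card (index_pairs n - {(2, 3)})"
      unfolding W6_def by (rule card_image) (auto simp: inj_on_def)
    moreover have "(2, 3) \<in> index_pairs n" by (simp add: index_pairs_def n)
    ultimately show ?thesis
      using card_index_pairs[of k] by (simp add: finite_index_pairs card_Diff_singleton n of_nat_diff)
  qed
  moreover have "card W7 = 2 * (k + 1) * (k + 2) + (k + 1) * (k + 2)^2"
    unfolding W7_def by (subst card_image) (auto simp: inj_on_def n card_index_triples)
  moreover have "int (card W8) = 2 * (k + 1) * (k + 2) + (k + 1) * (k + 2)^2 - 1"
  proof -
    have "card W8 = card (index_triples n - {(2, 4, 3)})"
      unfolding W8_def by (rule card_image) (auto simp: inj_on_def)
    moreover have "(2, 4, 3) \<in> index_triples n" by (simp add: index_triples_def index_pairs_def n)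
    ultimately show ?thesis
      using card_index_triples[of k] by (simp add: finite_index_triples card_Diff_singleton n of_nat_diff)
  qed
  ultimately show ?thesis
    by (simp add: n algebra_simps power2_eq_square power3_eq_cube)
qed

theorem theorem1p2:
  fixes n :: nat
  assumes "n \<ge> 4"
  shows "finite (qsym_G n)
    \<and> monic (qsym_G n)
    \<and> reduced (qsym_G n)
    \<and> groebner_basis (qsym_G n) (qsym_ideal n)
    \<and> int (card (qsym_G n)) = 4 * int n ^ 3 - 15 * int n ^ 2 + 16 * int n - 2"
proof -
  note G = qsym_G_eq_generator[OF assms] and lm = lm_generator[OF assms]
  have "finite (qsym_G n)" by (simp add: G finite_leading_words)
  moreover have "monic (qsym_G n)" using lm by (auto simp: monic_def G)
  moreover have "reduced (qsym_G n)"
    unfolding reduced_def G using lm sublist_leading_words[of _ n] by auto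
  moreover have "groebner_basis (qsym_G n) (qsym_ideal n)"
    unfolding groebner_basis_def
  proof (intro conjI ballI)
    show "qsym_G n \<subseteq> qsym_ideal n" using qsym_G_subset_qsym_ideal assms by simp
    fix f assume f: "f \<in> qsym_ideal n - {0}"
    then have "lm f \<in> lists (letters n)"
      using lm_in_keys[of f] qsym_ideal_carrier carrier_free_algebra by blast
    \<comment> \<open>By \<open>lm_qsym_ideal\<close> some index word of \<open>lm f\<close> is not
      admissible, so \<open>lm f\<close> cannot avoid all leading words.\<close>
    then obtain w where w: "w \<in> leading_words n" "sublist w (lm f)"
      using admissible_if_no_leading_word[OF assms, of "lm f"] lm_qsym_ideal[OF assms, of f] f by blast
    have "generator n w \<noteq> 0"
      using lm[OF w(1)] by (auto simp: lc_def)
    then have "generator n w \<in> qsym_G n - {0}" using w(1) by (simp add: G)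
    then show "\<exists>g\<in>qsym_G n - {0}. sublist (lm g) (lm f)"
      using lm[OF w(1)] w(2) by (intro bexI[of _ "generator n w"]) simp_all
  qed
  moreover have "card (qsym_G n) = card (leading_words n)"
    \<comment> \<open>A generator determines its leading word, so \<open>generator n\<close> is
      injective on \<open>leading_words n\<close>.\<close>
    unfolding G by (rule card_image, rule inj_onI) (metis lm)
  ultimately show ?thesis using card_leading_words[OF assms] by simp
qed

end
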